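(* Let $\alpha\in(0,1)$, $r\ge 1$, $T>0$, $L>0$, and let $u:[0,L]\times[0,T]\to\mathbb{R}$ be such that $u(x,\cdot)\in C[0,T]\cap C^4(0,T]$ for each $x$. Suppose that there is a constant $C$ such that $\left|\frac{\partial^l u(x,t)}{\partial t^l}\right|\le C(1+t^{\alpha-l})$ for all $x\in[0,L]$, $t\in(0,T]$ and $l=0,1,\ldots,4$. For positive integers $K_t,K_x$ consider the graded temporal mesh $t_n=T(n/K_t)^r$, $0\le n\le K_t$, with $\tau_n=t_n-t_{n-1}$, and the spatial mesh $x_i=iL/K_x$, and let ${}_CD_{0,t_{K_t}}^{\alpha}$ be the discrete Caputo operator on this mesh defined in the context. Then there exists a constant $C>0$, independent of the step sizes $\tau_n$ (hence of $K_t$), such that for all mesh points $(x_i,t_n)$ with $1\le i\le K_x-1$, $1\le n\le K_t$, $$\left|{}_CD_{0,t_{K_t}}^{\alpha}u(x_i,t_n)-{}_CD_{0,t}^{\alpha}u(x_i,t_n)\right|\le C\,n^{-\min\{4-\alpha,\;r\alpha\}}.$$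
   Context: Caputo derivative of order $\alpha\in(0,1)$ in time: ${}_CD_{0,t}^{\alpha}u(x,t)=\frac{1}{\Gamma(1-\alpha)}\int_0^t (t-s)^{-\alpha}\,\partial_s u(x,s)\,ds$. Discrete Caputo operator: for a function $v$ on the temporal mesh $0=t_0<t_1<\dots<t_{K_t}=T$, let $I_{11}v$ be the linear polynomial interpolating $v$ at $t_0,t_1$; let $I_{22}v$ be the quadratic polynomial interpolating $v$ at $t_0,t_1,t_2$; for $k\ge3$ let $I_{3k}v$ be the cubic polynomial interpolating $v$ at $t_{k-3},t_{k-2},t_{k-1},t_k$. Then for $1\le n\le K_t$, $${}_CD_{0,t_{K_t}}^{\alpha}v(t_n)=\frac{1}{\Gamma(1-\alpha)}\Big[\int_{t_0}^{t_1}(t_n-s)^{-\alpha}(I_{11}v)'(s)\,ds+\int_{t_1}^{t_2}(t_n-s)^{-\alpha}(I_{22}v)'(s)\,ds+\sum_{k=3}^{n}\int_{t_{k-1}}^{t_k}(t_n-s)^{-\alpha}(I_{3k}v)'(s)\,ds\Big],$$ where for $n=1$ only the first integral is present and for $n=2$ only the first two. For a function $u(x,t)$ the operator is applied to $v=u(x_i,\cdot)$, giving ${}_CD_{0,t_{K_t}}^{\alpha}u(x_i,t_n)$. *)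

theory Defs
  imports "HOL-Analysis.Analysis" "HOL-Computational_Algebra.Computational_Algebra"
begin

definition interpolant :: "(real \<Rightarrow> real) \<Rightarrow> real set \<Rightarrow> real poly" where
  "interpolant v X = (THE p. degree p < card X \<and> (\<forall>x\<in>X. poly p x = v x))"

(* The description in the definition above is proper for every finite nonempty set of nodes. *)
lemma interpolant_ex1:
  fixes v :: "real \<Rightarrow> real"
  assumes fin: "finite X" and ne: "X \<noteq> {}"
  shows "\<exists>!p :: real poly. degree p < card X \<and> (\<forall>x\<in>X. poly p x = v x)"
proof -
  define B :: "real \<Rightarrow> real poly" where
    "B = (\<lambda>a. \<Prod>b\<in>X - {a}. smult (1 / (a - b)) [:- b, 1:])"
  define p where "p = (\<Sum>a\<in>X. smult (v a) (B a))"
  have card_pos: "card X > 0"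
    using fin ne by (simp add: card_gt_0_iff)
  have deg_B: "degree (B a) \<le> card X - 1" if "a \<in> X" for a
  proof -
    have "degree (B a) \<le> (\<Sum>b\<in>X - {a}. degree (smult (1 / (a - b)) [:- b, 1:]))"
      unfolding B_def
      by (rule order.trans[OF degree_prod_sum_le]) (use fin in \<open>simp_all add: o_def\<close>)
    also have "\<dots> \<le> (\<Sum>b\<in>X - {a}. 1)"
      by (intro sum_mono) (auto intro: order.trans[OF degree_smult_le])
    also have "\<dots> = card X - 1"
      using that fin by simp
    finally show ?thesis .
  qed
  have "degree p \<le> card X - 1"
    unfolding p_def
    by (intro degree_sum_le fin order.trans[OF degree_smult_le] deg_B)
  then have "degree p < card X"
    using card_pos by linarith
  moreover have "poly p x = v x" if "x \<in> X" for x
  proof -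
    have "poly (B a) x = (if a = x then 1 else 0)" if "a \<in> X" for a
    proof (cases "a = x")
      case True
      then have "poly (B a) x = (\<Prod>b\<in>X - {x}. 1)"
        unfolding B_def poly_prod by (intro prod.cong) (auto simp flip: diff_divide_distrib)
      then show ?thesis
        using True by simp
    next
      case False
      have "\<exists>b\<in>X - {a}. poly (smult (1 / (a - b)) [:- b, 1:]) x = 0"
        using \<open>x \<in> X\<close> False by (intro bexI[of _ x]) auto
      then have "(\<Prod>b\<in>X - {a}. poly (smult (1 / (a - b)) [:- b, 1:]) x) = 0"
        using fin by (intro prod_zero) auto
      then show ?thesis
        using False unfolding B_def poly_prod by simp
    qed
    then have "poly p x = (\<Sum>a\<in>X. if a = x then v a else 0)"
      unfolding p_def poly_sum by (intro sum.cong) auto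
    then show ?thesis
      using that fin by simp
  qed
  moreover have "q = p'"
    if q: "degree q < card X" "\<forall>x\<in>X. poly q x = v x"
      and p': "degree p' < card X" "\<forall>x\<in>X. poly p' x = v x" for q p' :: "real poly"
    using q p' by (intro poly_eqI_degree[of X]) auto
  ultimately show ?thesis
    by blast
qed

lemma interpolant:
  assumes "finite X" "X \<noteq> {}"
  shows "degree (interpolant v X) < card X" "\<And>x. x \<in> X \<Longrightarrow> poly (interpolant v X) x = v x"
  using theI'[OF interpolant_ex1[OF assms, of v]] unfolding interpolant_def by blast+

(* At an endpoint belonging to S this is the one-sided derivative; when S is a nondegenerate
   interval, derivatives within S are unique. *)
fun deriv_within :: "nat \<Rightarrow> real set \<Rightarrow> (real \<Rightarrow> real) \<Rightarrow> real \<Rightarrow> real" where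
  "deriv_within 0 S f = f"
| "deriv_within (Suc l) S f = (\<lambda>t. vector_derivative (deriv_within l S f) (at t within S))"

definition C_on :: "nat \<Rightarrow> real set \<Rightarrow> (real \<Rightarrow> real) \<Rightarrow> bool" where
  "C_on k S f \<longleftrightarrow>
     (\<forall>l<k. deriv_within l S f differentiable_on S) \<and>
     (\<forall>l\<le>k. continuous_on S (deriv_within l S f))"

(* The values of deriv v at the endpoints 0 and t are arbitrary, but do not affect the integral. *)
definition caputo :: "real \<Rightarrow> (real \<Rightarrow> real) \<Rightarrow> real \<Rightarrow> real" where
  "caputo \<alpha> v t =
     1 / Gamma (1 - \<alpha>) * integral {0..t} (\<lambda>s. (t - s) powr (- \<alpha>) * deriv v s)"

definition graded_mesh :: "real \<Rightarrow> real \<Rightarrow> nat \<Rightarrow> nat \<Rightarrow> real" where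
  "graded_mesh T r K n = T * (real n / real K) powr r"

(* The contribution to the discrete Caputo operator at t n of the interval from t (k - 1) to t k,
   on which v is replaced by its interpolant at the nodes in X. *)
definition caputo_piece ::
    "real \<Rightarrow> (nat \<Rightarrow> real) \<Rightarrow> (real \<Rightarrow> real) \<Rightarrow> nat \<Rightarrow> nat \<Rightarrow> real set \<Rightarrow> real" where
  "caputo_piece \<alpha> t v n k X =
     integral {t (k - 1)..t k} (\<lambda>s. (t n - s) powr (- \<alpha>) * poly (pderiv (interpolant v X)) s)"

definition discrete_caputo ::
    "real \<Rightarrow> (nat \<Rightarrow> real) \<Rightarrow> (real \<Rightarrow> real) \<Rightarrow> nat \<Rightarrow> real" where
  "discrete_caputo \<alpha> t v n =
     1 / Gamma (1 - \<alpha>) *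
       (caputo_piece \<alpha> t v n 1 {t 0, t 1} +
        (if n \<ge> 2 then caputo_piece \<alpha> t v n 2 {t 0, t 1, t 2} else 0) +
        (\<Sum>k=3..n. caputo_piece \<alpha> t v n k {t (k - 3), t (k - 2), t (k - 1), t k}))"

end

theory Submission
  imports Defs
begin

text \<open>
  Let \<open>p\<^sub>k\<close> be the interpolant used on \<open>[t (k - 1), t k]\<close> and \<open>\<beta> = 1 + \<alpha>\<close>. Everything rests on the
  pointwise estimate \<open>\<bar>p\<^sub>k' s - v' s\<bar> \<le> C k powr (- 3) s powr (\<alpha> - 1)\<close> on that interval. For \<open>k \<ge> 4\<close> the nodes stay
  away from \<open>0\<close>, and Rolle's theorem applied repeatedly to \<open>p\<^sub>k - v\<close> bounds its first derivative by the
  cube of the stencil width times the fourth derivative of \<open>v\<close>. For \<open>k \<le> 3\<close> the nodes are a dilation of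
  fixed ones, so it suffices that interpolation on fixed nodes is a bounded map.

  Since \<open>p\<^sub>k - v\<close> vanishes at both ends of the interval, for \<open>k < n\<close> the kernel may be replaced by its
  increment over the interval. Writing \<open>t k = \<sigma> k powr r\<close> and using
  \<open>t n - t k \<ge> \<sigma> n powr (r - 1) (n - k)\<close>, the powers of \<open>\<sigma>\<close> cancel and the \<open>k\<close>-th contribution is at most
  a constant times \<open>n powr (- (r - 1) \<beta>) * k powr (r \<beta> - 5) * (n - k) powr (- \<beta>)\<close>. As \<open>m = min (4 - \<alpha>) (r \<alpha>)\<close>
  satisfies \<open>r \<beta> - 5 \<le> r \<beta> - m - \<beta>\<close> and \<open>m \<le> r \<beta>\<close>, the sum over \<open>k < n\<close> is at most a constant times
  \<open>n powr (- m)\<close>. The last interval contributes \<open>n powr (- (4 - \<alpha>))\<close> directly.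
\<close>

subsection \<open>Polynomial interpolation\<close>

text \<open>Induction adding the largest point of \<open>X\<close>: Rolle gives a zero between the
  old maximum and the new one. The clause \<open>y < Max X\<close> separates this zero from those
  found earlier, so the count is exact.\<close>

lemma Rolle_zeros:
  fixes f f' :: "real \<Rightarrow> real"
  assumes "finite X" "X \<noteq> {}" "X \<subseteq> {a..b}" "\<And>x. x \<in> X \<Longrightarrow> f x = 0"
    and "\<And>x. x \<in> {a..b} \<Longrightarrow> (f has_real_derivative f' x) (at x within {a..b})"
  shows "\<exists>Y. finite Y \<and> Suc (card Y) = card X \<and> Y \<subseteq> {a..b} \<and>
           (\<forall>y\<in>Y. f' y = 0 \<and> y < Max X)"
  using assms(1-4)
proof (induction X rule: finite_linorder_max_induct)
  case empty
  then show ?case by simp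
next
  case (insert c X)
  show ?case
  proof (cases "X = {}")
    case True
    then show ?thesis by (intro exI[of _ "{}"]) auto
  next
    case False
    have "X \<subseteq> {a..b}" "\<And>x. x \<in> X \<Longrightarrow> f x = 0" using insert.prems by auto
    then obtain Y where Y: "finite Y" "Suc (card Y) = card X" "Y \<subseteq> {a..b}"
      "\<And>y. y \<in> Y \<Longrightarrow> f' y = 0 \<and> y < Max X"
      using insert.IH[OF False] by blast
    define d where "d = Max X"
    have d: "d \<in> X" "d < c" using insert False by (auto simp: d_def)
    have sub: "{d..c} \<subseteq> {a..b}" using insert.prems(2) d by auto
    have "\<exists>z. d < z \<and> z < c \<and> (\<lambda>h. h * f' z) = (\<lambda>h. 0)"
    proof (rule Rolle_deriv[OF \<open>d < c\<close>])
      show "f d = f c" using insert.prems(3) d by auto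
      show "continuous_on {d..c} f"
        using DERIV_continuous_on[of "{a..b}" f f'] assms(5) continuous_on_subset[of "{a..b}" f "{d..c}"] sub
        by blast
      fix x assume x: "d < x" "x < c"
      then have "(f has_real_derivative f' x) (at x within {d<..<c})"
        using assms(5)[of x] sub by (meson DERIV_subset atLeastAtMost_iff greaterThanLessThan_subseteq_atLeastAtMost_iff less_imp_le order_refl subsetD)
      moreover have "at x within {d<..<c} = at x"
        using x by (intro at_within_open) auto
      ultimately show "(f has_derivative (\<lambda>h. h * f' x)) (at x)"
        unfolding has_field_derivative_def mult_commute_abs by metis
    qed
    then obtain z where z: "d < z" "z < c" "(\<lambda>h::real. h * f' z) = (\<lambda>h. 0)" by blast
    have "f' z = 0" using fun_cong[OF z(3), of 1] by simp
    have "Max (insert c X) = c" using insert by (intro Max_eqI) (auto intro: less_imp_le)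
    moreover have "z \<notin> Y" using Y(4) z d_def by force
    moreover have "c \<notin> X" using insert.hyps by auto
    moreover have "z \<in> {a..b}" using z sub by auto
    moreover have "f' y = 0 \<and> y < c" if "y \<in> Y" for y
      using Y(4)[OF that] d by (auto simp: d_def)
    ultimately show ?thesis
      using Y(1-3) z(2) \<open>f' z = 0\<close> insert.hyps(1)
      by (intro exI[of _ "insert z Y"]) simp
  qed
qed

text \<open>Repeated Rolle leaves \<open>card X - l\<close> zeros of \<open>f l\<close>, hence at
  least one for every \<open>l < card X\<close>. Starting from such a zero, the mean value
  inequality passes from order \<open>l + 1\<close> down to order \<open>l\<close> at the cost of
  one factor \<open>b - a\<close>.\<close>

lemma derivatives_bounded_of_zeros:
  fixes f :: "nat \<Rightarrow> real \<Rightarrow> real"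
  assumes "finite X" "X \<subseteq> {a..b}" "\<And>x. x \<in> X \<Longrightarrow> f 0 x = 0"
    and der: "\<And>l x. l < card X \<Longrightarrow> x \<in> {a..b} \<Longrightarrow>
               (f l has_real_derivative f (Suc l) x) (at x within {a..b})"
    and bd: "\<And>x. x \<in> {a..b} \<Longrightarrow> \<bar>f (card X) x\<bar> \<le> B"
    and "l \<le> card X" and "x \<in> {a..b}"
  shows "\<bar>f l x\<bar> \<le> B * (b - a) ^ (card X - l)"
proof -
  have "\<exists>Y. finite Y \<and> card Y + l = card X \<and> Y \<subseteq> {a..b} \<and> (\<forall>y\<in>Y. f l y = 0)"
    if "l \<le> card X" for l
    using that
  proof (induction l)
    case 0
    then show ?case using assms by (intro exI[of _ X]) auto
  next
    case (Suc l)
    then obtain Y where Y: "finite Y" "card Y + l = card X" "Y \<subseteq> {a..b}" "\<forall>y\<in>Y. f l y = 0"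
      by auto
    moreover have "Y \<noteq> {}" using Y Suc.prems by auto
    moreover have "l < card X" using Suc.prems by simp
    ultimately obtain Z where "finite Z" "Suc (card Z) = card Y" "Z \<subseteq> {a..b}" "\<forall>z\<in>Z. f (Suc l) z = 0"
      using Rolle_zeros[of Y a b "f l" "f (Suc l)"] der[of l] by blast
    then show ?case using Y by (intro exI[of _ Z]) auto
  qed
  note zeros = this
  show ?thesis using \<open>l \<le> card X\<close> \<open>x \<in> {a..b}\<close>
  proof (induction "card X - l" arbitrary: l x)
    case 0
    then show ?case using bd by simp
  next
    case (Suc d)
    then have l: "l < card X" "card X - l = Suc d" "card X - Suc l = d" by auto
    obtain Y where Y: "finite Y" "card Y + l = card X" "Y \<subseteq> {a..b}" "\<forall>y\<in>Y. f l y = 0"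
      using zeros[of l] l by auto
    then have "Y \<noteq> {}" using l by auto
    then obtain z where z: "z \<in> {a..b}" "f l z = 0" using Y by blast
    have B0: "B \<ge> 0" using bd[OF Suc.prems(2)] by linarith
    have "norm (f l x - f l z) \<le> (B * (b - a) ^ d) * norm (x - z)"
    proof (rule field_differentiable_bound[of "{a..b}" "f l" "f (Suc l)"])
      fix y assume "y \<in> {a..b}"
      then show "norm (f (Suc l) y) \<le> B * (b - a) ^ d"
        using Suc.hyps(1)[of "Suc l" y] l by auto
    qed (use der l z Suc.prems in auto)
    also have "\<dots> \<le> (B * (b - a) ^ d) * (b - a)"
      using z Suc.prems B0 by (intro mult_left_mono) auto
    finally show ?case using z l by (simp add: ac_simps)
  qed
qed

lemma interpolant_eqI:
  assumes "finite X" "degree p < card X" "\<And>x. x \<in> X \<Longrightarrow> poly p x = v x"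
  shows "interpolant v X = p"
proof -
  have "X \<noteq> {}" using assms by auto
  then show ?thesis
    using interpolant_ex1[OF assms(1), of v] interpolant[OF assms(1), where v = v] assms(2,3) by metis
qed

text \<open>The interpolant is the combination of the Lagrange basis polynomials \<open>L a\<close>
  with the nodal values as coefficients, and the derivatives of the \<open>L a\<close> are bounded
  on a compact interval. The order of quantifiers matters: \<open>A\<close> depends on the nodes and
  on \<open>R\<close>, but not on the data.\<close>

lemma interpolant_deriv_stable:
  assumes "finite X" "X \<noteq> {}"
  shows "\<exists>A\<ge>0. \<forall>(v :: real \<Rightarrow> real) B. (\<forall>x\<in>X. \<bar>v x\<bar> \<le> B) \<longrightarrow>
           (\<forall>y\<in>{0..R}. \<bar>poly (pderiv (interpolant v X)) y\<bar> \<le> A * B)"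
proof -
  define L where "L a = interpolant (\<lambda>x. if x = a then 1 else 0) X" for a
  note L = interpolant[OF assms, where v = "\<lambda>x. if x = _ then 1 else 0", folded L_def]
  have "\<exists>c\<ge>0. \<forall>y\<in>{0..R}. \<bar>poly (pderiv (L a)) y\<bar> \<le> c" for a
  proof -
    have "bounded ((\<lambda>y. poly (pderiv (L a)) y) ` {0..R})"
      by (intro compact_imp_bounded compact_continuous_image continuous_intros) auto
    then show ?thesis unfolding bounded_pos by (metis imageI less_imp_le real_norm_def)
  qed
  then obtain c where c: "\<And>a. c a \<ge> 0" "\<And>a y. y \<in> {0..R} \<Longrightarrow> \<bar>poly (pderiv (L a)) y\<bar> \<le> c a"
    by metis
  show ?thesis
  proof (intro exI[of _ "sum c X"] conjI allI impI ballI sum_nonneg c)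
    fix v :: "real \<Rightarrow> real" and B y assume v: "\<forall>x\<in>X. \<bar>v x\<bar> \<le> B" and y: "y \<in> {0..R}"
    have "interpolant v X = (\<Sum>a\<in>X. smult (v a) (L a))"
    proof (rule interpolant_eqI[OF assms(1)])
      have "degree (\<Sum>a\<in>X. smult (v a) (L a)) \<le> card X - 1"
      proof (intro degree_sum_le assms(1) order.trans[OF degree_smult_le])
        fix a show "degree (L a) \<le> card X - 1" using L(1)[of a] by linarith
      qed
      then show "degree (\<Sum>a\<in>X. smult (v a) (L a)) < card X"
        using assms card_gt_0_iff by (metis diff_less less_one order_le_less_trans)
    qed (use assms in \<open>simp add: poly_sum L(2) if_distrib[of "\<lambda>z. _ * z"] cong: if_cong\<close>)
    then have "pderiv (interpolant v X) = (\<Sum>a\<in>X. smult (v a) (pderiv (L a)))"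
      using sum_comp_morphism[of pderiv "\<lambda>a. smult (v a) (L a)" X]
      by (simp add: pderiv_add pderiv_smult o_def)
    then have "\<bar>poly (pderiv (interpolant v X)) y\<bar> = \<bar>\<Sum>a\<in>X. v a * poly (pderiv (L a)) y\<bar>"
      by (simp add: poly_sum)
    also have "\<dots> \<le> (\<Sum>a\<in>X. B * c a)"
    proof (rule order.trans[OF sum_abs sum_mono])
      fix a assume "a \<in> X"
      then have "\<bar>v a\<bar> \<le> B" using v by blast
      then show "\<bar>v a * poly (pderiv (L a)) y\<bar> \<le> B * c a"
        unfolding abs_mult using c(2)[OF y, of a] by (intro mult_mono) auto
    qed
    finally show "\<bar>poly (pderiv (interpolant v X)) y\<bar> \<le> sum c X * B"
      by (simp add: sum_distrib_left mult.commute)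
  qed
qed

text \<open>Interpolation commutes with dilations and with adding constants, and the derivative
  forgets the constant. The shift is used with \<open>c = w 0 0\<close>, which leaves only
  increments from the value at 0.\<close>

lemma pderiv_interpolant_rescale:
  fixes \<sigma> :: real
  assumes "finite Y" "Y \<noteq> {}" "\<sigma> > 0"
  shows "poly (pderiv (interpolant v ((*) \<sigma> ` Y))) s =
         poly (pderiv (interpolant (\<lambda>y. v (\<sigma> * y) - c) Y)) (s / \<sigma>) / \<sigma>"
proof -
  define P where "P = interpolant (\<lambda>y. v (\<sigma> * y) - c) Y"
  note P = interpolant[OF assms(1,2), where v = "\<lambda>y. v (\<sigma> * y) - c", folded P_def]
  have card: "card ((*) \<sigma> ` Y) = card Y"
    using assms by (intro card_image) (auto simp: inj_on_def)
  have "interpolant v ((*) \<sigma> ` Y) = pcompose P [:0, 1 / \<sigma>:] + [:c:]"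
  proof (rule interpolant_eqI)
    have "degree (pcompose P [:0, 1 / \<sigma>:] + [:c:]) \<le> degree P"
      by (intro degree_add_le order.trans[OF degree_pcompose_le]) auto
    then show "degree (pcompose P [:0, 1 / \<sigma>:] + [:c:]) < card ((*) \<sigma> ` Y)"
      using P(1) card by linarith
  qed (use assms P(2) in \<open>auto simp: poly_pcompose\<close>)
  moreover have "pderiv [:0, 1 / \<sigma>:] = [:1 / \<sigma>:]" "pderiv [:c:] = 0"
    by (simp_all add: pderiv_pCons)
  ultimately have "pderiv (interpolant v ((*) \<sigma> ` Y)) = pcompose (pderiv P) [:0, 1 / \<sigma>:] * [:1 / \<sigma>:]"
    by (metis add.right_neutral pderiv_add pderiv_pcompose)
  then have "poly (pderiv (interpolant v ((*) \<sigma> ` Y))) s =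
      poly (pcompose (pderiv P) [:0, 1 / \<sigma>:] * [:1 / \<sigma>:]) s"
    by (rule arg_cong)
  also have "\<dots> = poly (pderiv P) (s / \<sigma>) / \<sigma>"
    by (simp add: poly_pcompose)
  finally show ?thesis unfolding P_def .
qed

subsection \<open>Weakly singular integrals and power sums\<close>

text \<open>Substituting \<open>s = t * x\<close> reduces to the Beta integral on
  \<open>{0..1}\<close>. The exponents add up to -1, which cancels the scaling of the measure, so
  the value is independent of \<open>t\<close>.\<close>

lemma has_integral_weakly_singular_Beta:
  fixes \<alpha> t :: real
  assumes "0 < \<alpha>" "\<alpha> < 1" "0 < t"
  shows "((\<lambda>s. (t - s) powr (- \<alpha>) * s powr (\<alpha> - 1)) has_integral Beta \<alpha> (1 - \<alpha>)) {0..t}"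
proof -
  define f where "f = (\<lambda>s. s powr (\<alpha> - 1) * (1 - s) powr (- \<alpha>) :: real)"
  have "(f has_integral Beta \<alpha> (1 - \<alpha>)) {0..1}"
    using has_integral_Beta_real[of \<alpha> "1 - \<alpha>"] assms by (simp add: f_def)
  from has_integral_stretch_real[OF this, of "1 / t"]
  have "((\<lambda>s. f (1 / t * s)) has_integral t * Beta \<alpha> (1 - \<alpha>)) ((\<lambda>x. x / (1 / t)) ` {0..1})"
    using assms by simp
  moreover have "(\<lambda>x. x / (1 / t)) ` {0..1} = {0..t}"
    using image_mult_atLeastAtMost[of t 0 1] assms by (simp add: mult.commute)
  ultimately have H: "((\<lambda>s. f (1 / t * s) * (1 / t)) has_integral t * Beta \<alpha> (1 - \<alpha>) * (1 / t)) {0..t}"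
    by (intro has_integral_mult_left) simp
  have "f (1 / t * s) * (1 / t) = (t - s) powr (- \<alpha>) * s powr (\<alpha> - 1)" if "s \<in> {0..t}" for s
  proof -
    have "f (1 / t * s) = (s / t) powr (\<alpha> - 1) * ((t - s) / t) powr (- \<alpha>)"
      using assms by (simp add: f_def diff_divide_distrib)
    also have "\<dots> = s powr (\<alpha> - 1) * (t - s) powr (- \<alpha>) / (t powr (\<alpha> - 1) * t powr (- \<alpha>))"
      using assms that by (simp add: powr_divide)
    also have "t powr (\<alpha> - 1) * t powr (- \<alpha>) = t powr (- 1)"
      by (simp flip: powr_add)
    also have "\<dots> = 1 / t"
      using assms by (simp add: powr_minus_divide)
    finally show ?thesis using assms by simp
  qed
  from has_integral_eq[OF this H] show ?thesis
    using assms by simp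
qed

text \<open>Domination by the Beta integrand. Measurability and domination are checked on the open
  interval, so \<open>w\<close> may be singular or arbitrary at the end points.\<close>

lemma integrable_weakly_singular:
  fixes \<alpha> t :: real and w :: "real \<Rightarrow> real"
  assumes \<alpha>: "0 < \<alpha>" "\<alpha> < 1" "0 < t" and cont: "continuous_on {0<..<t} w"
    and bd: "\<And>s. s \<in> {0<..<t} \<Longrightarrow> \<bar>w s\<bar> \<le> C * s powr (\<alpha> - 1)"
  shows "(\<lambda>s. (t - s) powr (- \<alpha>) * w s) integrable_on {0..t}"
proof -
  have "(\<lambda>s. C * ((t - s) powr (- \<alpha>) * s powr (\<alpha> - 1))) integrable_on {0<..<t}"
    using has_integral_integrable[OF has_integral_weakly_singular_Beta[OF \<alpha>]]
    by (intro integrable_on_mult_right) (simp add: integrable_on_Icc_iff_Ioo)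
  moreover have "continuous_on {0<..<t} (\<lambda>s. (t - s) powr (- \<alpha>) * w s)"
    by (intro continuous_intros cont) auto
  moreover have "norm ((t - s) powr (- \<alpha>) * w s) \<le> C * ((t - s) powr (- \<alpha>) * s powr (\<alpha> - 1))"
    if "s \<in> {0<..<t}" for s
    using mult_left_mono[OF bd[OF that], of "(t - s) powr (- \<alpha>)"] by (simp add: abs_mult ac_simps)
  ultimately have "(\<lambda>s. (t - s) powr (- \<alpha>) * w s) absolutely_integrable_on {0<..<t}"
    by (intro measurable_bounded_by_integrable_imp_absolutely_integrable
          [where g = "\<lambda>s. C * ((t - s) powr (- \<alpha>) * s powr (\<alpha> - 1))"]
        continuous_imp_measurable_on_sets_lebesgue) auto
  then have "(\<lambda>s. (t - s) powr (- \<alpha>) * w s) integrable_on {0<..<t}"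
    by (rule set_lebesgue_integral_eq_integral(1))
  then show ?thesis by (simp add: integrable_on_Icc_iff_Ioo)
qed

lemma abs_integral_le_open:
  fixes f g :: "real \<Rightarrow> real"
  assumes "f integrable_on {a..b}" "(g has_integral I) {a..b}"
    and "\<And>s. s \<in> {a<..<b} \<Longrightarrow> \<bar>f s\<bar> \<le> g s"
  shows "\<bar>integral {a..b} f\<bar> \<le> I"
proof -
  have "norm (integral {a<..<b} f) \<le> integral {a<..<b} g"
    using assms
    by (intro integral_norm_bound_integral) (auto simp: integrable_on_Icc_iff_Ioo)
  then show ?thesis
    using integral_unique[OF assms(2)] integral_open_interval_real[of a b f]
      integral_open_interval_real[of a b g] by simp
qed

lemma has_integral_powr_Icc:
  fixes a b p :: real
  assumes "p > 0" "0 \<le> a" "a \<le> b"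
  shows "((\<lambda>s. s powr (p - 1)) has_integral (b powr p - a powr p) / p) {a..b}"
proof -
  have "((\<lambda>s. s powr (p - 1)) has_integral b powr p / p - a powr p / p) {a..b}"
    using assms
    by (intro fundamental_theorem_of_calculus_interior continuous_intros continuous_on_powr')
       (auto intro!: derivative_eq_intros simp flip: has_real_derivative_iff_has_vector_derivative)
  then show ?thesis by (simp add: diff_divide_distrib)
qed

lemma has_integral_powr_reflect:
  fixes a b p :: real
  assumes "p > 0" "a \<le> b"
  shows "((\<lambda>s. (b - s) powr (p - 1)) has_integral (b - a) powr p / p) {a..b}"
proof -
  have "((\<lambda>s. (b - s) powr (p - 1)) has_integral - ((b - b) powr p / p) - - ((b - a) powr p / p)) {a..b}"
    using assms
    by (intro fundamental_theorem_of_calculus_interior[where f = "\<lambda>s. - ((b - s) powr p / p)"]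
          continuous_intros continuous_on_powr')
       (auto intro!: derivative_eq_intros simp flip: has_real_derivative_iff_has_vector_derivative)
  then show ?thesis by simp
qed

text \<open>Mean value inequality in \<open>s\<close>: the derivative of the kernel increases
  towards its singularity \<open>c\<close>, hence is largest at \<open>b\<close>.\<close>

lemma powr_kernel_increment:
  fixes a b c s \<alpha> :: real
  assumes "0 < \<alpha>" "b < c" "a \<le> s" "s \<le> b"
  shows "\<bar>(c - s) powr (- \<alpha>) - (c - a) powr (- \<alpha>)\<bar> \<le> \<alpha> * (b - a) * (c - b) powr (- \<alpha> - 1)"
proof -
  have "norm ((c - s) powr (- \<alpha>) - (c - a) powr (- \<alpha>)) \<le> (\<alpha> * (c - b) powr (- \<alpha> - 1)) * norm (s - a)"
  proof (rule field_differentiable_bound[of "{a..b}" _ "\<lambda>s. \<alpha> * (c - s) powr (- \<alpha> - 1)"])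
    fix z assume z: "z \<in> {a..b}"
    show "((\<lambda>s. (c - s) powr (- \<alpha>)) has_field_derivative \<alpha> * (c - z) powr (- \<alpha> - 1)) (at z within {a..b})"
      using z assms by (auto intro!: derivative_eq_intros)
    have "(c - z) powr (- \<alpha> - 1) \<le> (c - b) powr (- \<alpha> - 1)"
      using z assms by (intro powr_mono2') auto
    then show "norm (\<alpha> * (c - z) powr (- \<alpha> - 1)) \<le> \<alpha> * (c - b) powr (- \<alpha> - 1)"
      using assms by (simp add: abs_mult)
  qed (use assms in auto)
  also have "\<dots> \<le> (\<alpha> * (c - b) powr (- \<alpha> - 1)) * (b - a)"
    using assms by (intro mult_left_mono) auto
  finally show ?thesis by (simp add: ac_simps)
qed

text \<open>Because \<open>w\<close> has mean zero, the kernel may be replaced by its increment on the interval;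
  this takes the place of an integration by parts and gains the factor \<open>b - a\<close>.\<close>

lemma weakly_singular_history_bound:
  fixes a b c \<alpha> :: real and w :: "real \<Rightarrow> real"
  assumes "0 < \<alpha>" "0 \<le> a" "a \<le> b" "b < c"
    and w0: "(w has_integral 0) {a..b}"
    and int: "(\<lambda>s. (c - s) powr (- \<alpha>) * w s) integrable_on {a..b}"
    and bd: "\<And>s. s \<in> {a<..<b} \<Longrightarrow> \<bar>w s\<bar> \<le> B * s powr (\<alpha> - 1)"
  shows "\<bar>integral {a..b} (\<lambda>s. (c - s) powr (- \<alpha>) * w s)\<bar>
           \<le> B * (b - a) * (c - b) powr (- \<alpha> - 1) * (b powr \<alpha> - a powr \<alpha>)"
proof -
  define D where "D = \<alpha> * (b - a) * (c - b) powr (- \<alpha> - 1)"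
  define f where "f = (\<lambda>s. (c - s) powr (- \<alpha>) * w s - (c - a) powr (- \<alpha>) * w s)"
  have w0': "((\<lambda>s. (c - a) powr (- \<alpha>) * w s) has_integral 0) {a..b}"
    using has_integral_mult_right[OF w0] by simp
  have f: "f integrable_on {a..b}"
    unfolding f_def by (intro integrable_diff int has_integral_integrable[OF w0'])
  have "integral {a..b} (\<lambda>s. (c - s) powr (- \<alpha>) * w s) = integral {a..b} f"
    unfolding f_def using integral_diff[OF int has_integral_integrable[OF w0']] integral_unique[OF w0']
    by simp
  also have "\<bar>integral {a..b} f\<bar> \<le> D * B * ((b powr \<alpha> - a powr \<alpha>) / \<alpha>)"
  proof (rule abs_integral_le_open[OF f])
    show "((\<lambda>s. D * B * s powr (\<alpha> - 1)) has_integral D * B * ((b powr \<alpha> - a powr \<alpha>) / \<alpha>)) {a..b}"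
      using assms by (intro has_integral_mult_right has_integral_powr_Icc) auto
    fix s assume s: "s \<in> {a<..<b}"
    have "\<bar>f s\<bar> = \<bar>(c - s) powr (- \<alpha>) - (c - a) powr (- \<alpha>)\<bar> * \<bar>w s\<bar>"
      by (simp add: f_def abs_mult flip: left_diff_distrib)
    also have "\<dots> \<le> D * (B * s powr (\<alpha> - 1))"
      unfolding D_def using s assms powr_kernel_increment[of \<alpha> b c a s] bd[OF s]
      by (intro mult_mono) auto
    finally show "\<bar>f s\<bar> \<le> D * B * s powr (\<alpha> - 1)" by (simp add: ac_simps)
  qed
  finally show ?thesis
    using assms by (simp add: D_def ac_simps)
qed

text \<open>The kernel is singular at the right end, so its increment is of no use here. Since
  \<open>a > 0\<close>, the power of \<open>s\<close> can instead be frozen at \<open>a\<close> and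
  the kernel integrated exactly.\<close>

lemma weakly_singular_last_bound:
  fixes a b \<alpha> :: real and w :: "real \<Rightarrow> real"
  assumes "0 < \<alpha>" "\<alpha> < 1" "0 < a" "a \<le> b" "0 \<le> B"
    and int: "(\<lambda>s. (b - s) powr (- \<alpha>) * w s) integrable_on {a..b}"
    and bd: "\<And>s. s \<in> {a<..<b} \<Longrightarrow> \<bar>w s\<bar> \<le> B * s powr (\<alpha> - 1)"
  shows "\<bar>integral {a..b} (\<lambda>s. (b - s) powr (- \<alpha>) * w s)\<bar>
           \<le> B * a powr (\<alpha> - 1) * (b - a) powr (1 - \<alpha>) / (1 - \<alpha>)"
proof -
  have "\<bar>integral {a..b} (\<lambda>s. (b - s) powr (- \<alpha>) * w s)\<bar>
      \<le> B * a powr (\<alpha> - 1) * ((b - a) powr (1 - \<alpha>) / (1 - \<alpha>))"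
  proof (rule abs_integral_le_open[OF int])
    show "((\<lambda>s. B * a powr (\<alpha> - 1) * (b - s) powr (- \<alpha>)) has_integral
        B * a powr (\<alpha> - 1) * ((b - a) powr (1 - \<alpha>) / (1 - \<alpha>))) {a..b}"
      using has_integral_powr_reflect[of "1 - \<alpha>" a b] assms
      by (intro has_integral_mult_right) simp
    fix s assume s: "s \<in> {a<..<b}"
    have "s powr (\<alpha> - 1) \<le> a powr (\<alpha> - 1)" using s assms by (intro powr_mono2') auto
    then have "\<bar>w s\<bar> \<le> B * a powr (\<alpha> - 1)"
      using bd[OF s] mult_left_mono[OF _ \<open>0 \<le> B\<close>] order.trans by blast
    then show "\<bar>(b - s) powr (- \<alpha>) * w s\<bar> \<le> B * a powr (\<alpha> - 1) * (b - s) powr (- \<alpha>)"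
      by (simp add: abs_mult mult.commute[of "\<bar>w s\<bar>"] mult.commute[of _ "(b - s) powr (- \<alpha>)"] mult_left_mono)
  qed
  then show ?thesis by simp
qed

text \<open>With left end 0 both end points are singular, and the Beta integral absorbs both. The
  bound does not contain \<open>b\<close>, hence no mesh scale.\<close>

lemma weakly_singular_first_bound:
  fixes b \<alpha> :: real and w :: "real \<Rightarrow> real"
  assumes "0 < \<alpha>" "\<alpha> < 1" "0 < b"
    and int: "(\<lambda>s. (b - s) powr (- \<alpha>) * w s) integrable_on {0..b}"
    and bd: "\<And>s. s \<in> {0<..<b} \<Longrightarrow> \<bar>w s\<bar> \<le> B * s powr (\<alpha> - 1)"
  shows "\<bar>integral {0..b} (\<lambda>s. (b - s) powr (- \<alpha>) * w s)\<bar> \<le> B * Beta \<alpha> (1 - \<alpha>)"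
proof -
  have "((\<lambda>s. B * ((b - s) powr (- \<alpha>) * s powr (\<alpha> - 1))) has_integral B * Beta \<alpha> (1 - \<alpha>)) {0..b}"
    using assms by (intro has_integral_mult_right has_integral_weakly_singular_Beta)
  then show ?thesis
  proof (rule abs_integral_le_open[OF int])
    fix s assume s: "s \<in> {0<..<b}"
    show "\<bar>(b - s) powr (- \<alpha>) * w s\<bar> \<le> B * ((b - s) powr (- \<alpha>) * s powr (\<alpha> - 1))"
      using mult_left_mono[OF bd[OF s], of "(b - s) powr (- \<alpha>)"] by (simp add: abs_mult ac_simps)
  qed
qed

section \<open>Differences of powers and a discrete convolution\<close>

lemma powr_diff_ge:
  fixes x y r :: real
  assumes "0 \<le> x" "x \<le> y" "1 \<le> r"
  shows "(y - x) * y powr (r - 1) \<le> y powr r - x powr r"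
proof (cases "x = 0")
  case True
  then show ?thesis using assms by (cases "y = 0") (auto simp: powr_mult_base)
next
  case False
  have "x * x powr (r - 1) \<le> x * y powr (r - 1)"
    using assms by (intro mult_left_mono powr_mono2) auto
  then show ?thesis using assms False by (simp add: powr_mult_base algebra_simps)
qed

lemma powr_diff_le:
  fixes x y r :: real
  assumes "0 \<le> x" "x \<le> y" "1 \<le> r"
  shows "y powr r - x powr r \<le> r * y powr (r - 1) * (y - x)"
proof -
  have "((\<lambda>s. s powr (r - 1)) has_integral (y powr r - x powr r) / r) {x..y}"
    using assms by (intro has_integral_powr_Icc) auto
  moreover have "((\<lambda>s. y powr (r - 1)) has_integral (y - x) * y powr (r - 1)) {x..y}"
    using has_integral_const_real[of "y powr (r - 1)" x y] assms by simp
  ultimately have "(y powr r - x powr r) / r \<le> (y - x) * y powr (r - 1)"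
    by (rule has_integral_le) (use assms in \<open>auto intro: powr_mono2\<close>)
  then show ?thesis using assms by (simp add: field_simps)
qed

text \<open>For exponents up to 1, \<open>x powr (\<alpha> - 1)\<close> is at least
  \<open>y powr (\<alpha> - 1)\<close>; multiplying by \<open>x\<close> gives the claim. This turns
  an increment of \<open>t k powr \<alpha>\<close> into a second factor of the interval
  length.\<close>

lemma powr_diff_le_concave:
  fixes x y \<alpha> :: real
  assumes "0 \<le> x" "x \<le> y" "0 < y" "\<alpha> \<le> 1"
  shows "y powr \<alpha> - x powr \<alpha> \<le> y powr (\<alpha> - 1) * (y - x)"
proof (cases "x = 0")
  case True
  then show ?thesis using assms by (simp add: powr_mult_base mult.commute)
next
  case False
  have "x * y powr (\<alpha> - 1) \<le> x * x powr (\<alpha> - 1)"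
    using assms False by (intro mult_left_mono powr_mono2') auto
  then show ?thesis using assms False by (simp add: powr_mult_base algebra_simps)
qed

text \<open>One of \<open>k\<close> and \<open>n - k\<close> is at least \<open>n / 2\<close>, so
  one of the two decaying factors is already of size \<open>n powr (- \<beta>)\<close>, while the
  other is summable because \<open>\<beta> > 1\<close>. The growth \<open>k powr e\<close> is
  bounded by \<open>n powr e\<close>. The two cases turn \<open>2 powr \<beta>\<close> into
  \<open>2 powr (\<beta> + 1)\<close>.\<close>

lemma convolution_powr_sum_le:
  fixes e \<beta> :: real
  assumes "0 \<le> e" "1 < \<beta>"
  shows "(\<Sum>k=1..<n. real k powr (e - \<beta>) * (real n - real k) powr (- \<beta>))
           \<le> 2 powr (\<beta> + 1) * (\<Sum>k. real k powr (- \<beta>)) * real n powr (e - \<beta>)"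
proof -
  \<comment> \<open>The term for \<open>k = 0\<close> vanishes since \<open>0 powr a = 0\<close>, so
    this is the zeta value at \<beta>.\<close>
  define Z where "Z = (\<Sum>k. real k powr (- \<beta>))"
  have sm: "summable (\<lambda>k. real k powr (- \<beta>))"
    using assms by (simp add: summable_real_powr_iff)
  have Z1: "(\<Sum>k=1..<n. real k powr (- \<beta>)) \<le> Z"
    unfolding Z_def by (intro sum_le_suminf sm) auto
  have "(\<Sum>k=1..<n. real (n - k) powr (- \<beta>)) = (\<Sum>k=1..<n. real k powr (- \<beta>))"
    by (rule sum.reindex_bij_witness[of _ "\<lambda>k. n - k" "\<lambda>k. n - k"]) auto
  then have Z2: "(\<Sum>k=1..<n. (real n - real k) powr (- \<beta>)) \<le> Z"
    using Z1 by (simp add: of_nat_diff)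
  have summand: "real k powr (e - \<beta>) * (real n - real k) powr (- \<beta>)
      \<le> 2 powr \<beta> * real n powr (e - \<beta>) * ((real n - real k) powr (- \<beta>) + real k powr (- \<beta>))"
    if "k \<in> {1..<n}" for k
  proof -
    define x y where "x = real k" and "y = real n - real k"
    have xy: "x > 0" "y > 0" "real n = x + y" using that by (auto simp: x_def y_def)
    have "(x + y) powr \<beta> \<le> (2 * max x y) powr \<beta>"
      using xy assms by (intro powr_mono2) auto
    also have "\<dots> = 2 powr \<beta> * (max x y) powr \<beta>" using xy by (simp add: powr_mult)
    also have "\<dots> \<le> 2 powr \<beta> * (x powr \<beta> + y powr \<beta>)"
      by (intro mult_left_mono) (auto simp: max_def)
    finally have A: "(x + y) powr \<beta> \<le> 2 powr \<beta> * (x powr \<beta> + y powr \<beta>)" .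
    have "x powr e \<le> (x + y) powr e" using xy assms by (intro powr_mono2) auto
    \<comment> \<open>Dividing this inequality by \<open>(x * y * (x + y)) powr \<beta>\<close>
      gives the claimed bound on the summand.\<close>
    then have "x powr e * (x + y) powr \<beta> \<le> (x + y) powr e * (2 powr \<beta> * (x powr \<beta> + y powr \<beta>))"
      using A by (intro mult_mono) auto
    then show ?thesis
      unfolding xy(3) x_def[symmetric] y_def[symmetric] using xy
      by (simp add: powr_diff powr_minus field_simps)
  qed
  have "(\<Sum>k=1..<n. real k powr (e - \<beta>) * (real n - real k) powr (- \<beta>))
      \<le> (\<Sum>k=1..<n. 2 powr \<beta> * real n powr (e - \<beta>) * ((real n - real k) powr (- \<beta>) + real k powr (- \<beta>)))"
    by (rule sum_mono[OF summand])
  also have "\<dots> = 2 powr \<beta> * real n powr (e - \<beta>) *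
      ((\<Sum>k=1..<n. (real n - real k) powr (- \<beta>)) + (\<Sum>k=1..<n. real k powr (- \<beta>)))"
    by (simp only: sum_distrib_left[symmetric] sum.distrib)
  also have "\<dots> \<le> 2 powr \<beta> * real n powr (e - \<beta>) * (Z + Z)"
    using Z1 Z2 by (intro mult_left_mono add_mono) auto
  finally show ?thesis by (simp add: Z_def powr_add ac_simps)
qed

subsection \<open>Interpolation error on the graded mesh\<close>

text \<open>The function \<open>w l\<close> plays the role of the \<open>l\<close>-th time
  derivative at one fixed point in space. The bounds are pure powers: the summand 1 in the
  hypothesis of the theorem is absorbed into \<open>M\<close>. Derivatives are taken within
  \<open>{0<..T}\<close>, hence one-sided at \<open>T\<close>, and at 0 only continuity of
  \<open>w 0\<close> is available.\<close>

locale weakly_singular =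
  fixes \<alpha> T M :: real and w :: "nat \<Rightarrow> real \<Rightarrow> real"
  assumes \<alpha>: "0 < \<alpha>" "\<alpha> < 1" and T: "0 < T"
    and continuous: "continuous_on {0..T} (w 0)"
    and deriv: "\<And>l s. l < 4 \<Longrightarrow> s \<in> {0<..T} \<Longrightarrow>
      (w l has_real_derivative w (Suc l) s) (at s within {0<..T})"
    and bound: "\<And>l s. 1 \<le> l \<Longrightarrow> l \<le> 4 \<Longrightarrow> s \<in> {0<..T} \<Longrightarrow>
      \<bar>w l s\<bar> \<le> M * s powr (\<alpha> - real l)"
begin

lemma M_nonneg: "0 \<le> M"
proof -
  have "0 \<le> M * T powr (\<alpha> - real 1)"
    using bound[of 1 T] T by (intro order.trans[OF abs_ge_zero]) auto
  then show ?thesis using T by (simp add: zero_le_mult_iff)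
qed

lemma deriv_at:
  assumes "l < 4" "s \<in> {0<..<T}"
  shows "(w l has_real_derivative w (Suc l) s) (at s)"
proof -
  have "(w l has_real_derivative w (Suc l) s) (at s within {0<..<T})"
    using deriv[of l s] assms by (auto intro: DERIV_subset)
  moreover have "at s within {0<..<T} = at s"
    using assms by (intro at_within_open) auto
  ultimately show ?thesis by metis
qed

lemma bound_1: "s \<in> {0<..T} \<Longrightarrow> \<bar>w 1 s\<bar> \<le> M * s powr (\<alpha> - 1)"
  using bound[of 1 s] by simp

text \<open>The singularity of \<open>w 1\<close> is integrable, and continuity of
  \<open>w 0\<close> at 0 lets the fundamental theorem reach the end point.\<close>

lemma increment_bound:
  assumes "0 \<le> s" "s \<le> T"
  shows "\<bar>w 0 s - w 0 0\<bar> \<le> M / \<alpha> * s powr \<alpha>"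
proof -
  have "(w 1 has_integral (w 0 s - w 0 0)) {0..s}"
  proof (rule fundamental_theorem_of_calculus_interior)
    show "continuous_on {0..s} (w 0)"
      by (rule continuous_on_subset[OF continuous]) (use assms in auto)
    fix x assume "x \<in> {0<..<s}"
    then show "(w 0 has_vector_derivative w 1 x) (at x)"
      using deriv_at[of 0 x] assms by (simp add: has_real_derivative_iff_has_vector_derivative)
  qed (use assms in auto)
  then have "w 1 integrable_on {0..s}" "integral {0..s} (w 1) = w 0 s - w 0 0" by auto
  moreover have "((\<lambda>x. M * x powr (\<alpha> - 1)) has_integral M * ((s powr \<alpha> - 0 powr \<alpha>) / \<alpha>)) {0..s}"
    using assms \<alpha> by (intro has_integral_mult_right has_integral_powr_Icc) auto
  ultimately have "\<bar>w 0 s - w 0 0\<bar> \<le> M * ((s powr \<alpha> - 0 powr \<alpha>) / \<alpha>)"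
    using abs_integral_le_open[of "w 1" 0 s] bound_1 assms by auto
  then show ?thesis by simp
qed

text \<open>The error vanishes at four nodes, and its fourth derivative is that of
  \<open>w 0\<close> because the interpolant is at most cubic. The repeated Rolle argument with
  \<open>l = 1\<close> then costs three factors \<open>b - a\<close>; the fourth derivative is
  largest, as far as its bound shows, at the left end \<open>a\<close>.\<close>

lemma cubic_interpolation_deriv_error:
  assumes "finite X" "card X = 4" "X \<subseteq> {a..b}" "0 < a" "b \<le> T" "s \<in> {a..b}"
  shows "\<bar>poly (pderiv (interpolant (w 0) X)) s - w 1 s\<bar> \<le> M * a powr (\<alpha> - 4) * (b - a) ^ 3"
proof -
  define p where "p = interpolant (w 0) X"
  have "X \<noteq> {}" using assms by auto
  note p = interpolant[OF \<open>finite X\<close> this, where v = "w 0", folded p_def]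
  define f where "f l x = w l x - poly ((pderiv ^^ l) p) x" for l x
  have sub: "{a..b} \<subseteq> {0<..T}" using assms by auto
  have p4: "(pderiv ^^ 4) p = 0"
  proof -
    have "degree ((pderiv ^^ 3) p) = 0"
      using p(1) assms by (simp add: degree_higher_pderiv)
    then show ?thesis
      using pderiv_eq_0_iff[of "(pderiv ^^ 3) p"] by (simp add: eval_nat_numeral)
  qed
  have "\<bar>f 1 s\<bar> \<le> (M * a powr (\<alpha> - 4)) * (b - a) ^ (card X - 1)"
  proof (rule derivatives_bounded_of_zeros[where f = f and l = 1, OF assms(1,3)])
    show "f 0 x = 0" if "x \<in> X" for x
      using p(2)[OF that] by (simp add: f_def)
    show "(f l has_real_derivative f (Suc l) x) (at x within {a..b})"
      if "l < card X" "x \<in> {a..b}" for l x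
    proof -
      have "(w l has_real_derivative w (Suc l) x) (at x within {a..b})"
        using deriv[of l x] that assms sub by (intro DERIV_subset[OF _ sub]) auto
      from DERIV_diff[OF this has_field_derivative_at_within[OF poly_DERIV[of "(pderiv ^^ l) p" x]]]
      show ?thesis by (simp add: f_def[abs_def])
    qed
    show "\<bar>f (card X) x\<bar> \<le> M * a powr (\<alpha> - 4)" if "x \<in> {a..b}" for x
    proof -
      have "\<bar>f (card X) x\<bar> \<le> M * x powr (\<alpha> - 4)"
        using bound[of 4 x] that sub p4 assms(2) by (auto simp: f_def)
      also have "\<dots> \<le> M * a powr (\<alpha> - 4)"
        using that assms \<alpha> M_nonneg by (intro mult_left_mono powr_mono2') auto
      finally show ?thesis .
    qed
  qed (use assms in auto)
  then show ?thesis
    using assms(2) by (simp add: f_def p_def abs_minus_commute)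
qed

end

text \<open>The nodes \<open>t (k - 3), \<dots>, t k\<close> are indexed by \<open>{k - 3..k}\<close>; truncated subtraction makes this
  \<open>{0..k}\<close> for \<open>k \<le> 3\<close>, as needed on the first intervals.\<close>

definition stencil_error :: "(nat \<Rightarrow> real) \<Rightarrow> (nat \<Rightarrow> real \<Rightarrow> real) \<Rightarrow> nat \<Rightarrow> real \<Rightarrow> real" where
  "stencil_error t w k s = poly (pderiv (interpolant (w 0) (t ` {k - 3..k}))) s - w 1 s"

text \<open>The number of mesh intervals enters only through the scale
  \<open>\<sigma> = T / Kt powr r\<close>. Estimates in which \<sigma> cancels are therefore uniform
  in the mesh. The sequence \<open>t\<close> runs over all naturals; the lemmas restrict to indices
  with \<open>t k \<le> T\<close>.\<close>

locale weakly_singular_graded = weakly_singular +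
  fixes r \<sigma> :: real and t :: "nat \<Rightarrow> real"
  assumes r: "1 \<le> r" and \<sigma>: "0 < \<sigma>" and t: "\<And>k. t k = \<sigma> * real k powr r"
begin

lemma t_0 [simp]: "t 0 = 0"
  by (simp add: t)

lemma t_mono: "j \<le> k \<Longrightarrow> t j \<le> t k"
  using \<sigma> r by (auto simp: t intro!: powr_mono2)

lemma t_strict_mono: "strict_mono t"
  using \<sigma> r by (auto simp: strict_mono_def t intro!: powr_less_mono2)

lemma t_pos: "0 < k \<Longrightarrow> 0 < t k"
  using \<sigma> by (simp add: t)

lemma t_diff_le: "j \<le> k \<Longrightarrow> t k - t j \<le> \<sigma> * r * real k powr (r - 1) * (real k - real j)"
  using mult_left_mono[OF powr_diff_le[of "real j" "real k" r], of \<sigma>] \<sigma> r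
  by (simp add: t algebra_simps)

lemma t_diff_ge: "j \<le> k \<Longrightarrow> \<sigma> * real k powr (r - 1) * (real k - real j) \<le> t k - t j"
  using mult_left_mono[OF powr_diff_ge[of "real j" "real k" r], of \<sigma>] \<sigma> r
  by (simp add: t algebra_simps)

text \<open>For \<open>k \<ge> 4\<close> one has \<open>k - 3 \<ge> k / 4\<close>, so the leftmost
  node is comparable to \<open>t k\<close>, while the stencil width is of order
  \<open>t k / k\<close>. Thus \<open>t k powr (\<alpha> - 4)\<close> times the cubed width gives
  \<open>t k powr (\<alpha> - 1) / k ^ 3\<close>. The factor 27 comes from the three intervals of
  the stencil, \<open>4 powr (4 * r)\<close> from the comparison of nodes.\<close>

lemma stencil_error_interior:
  assumes k: "4 \<le> k" "t k \<le> T" and s: "s \<in> {t (k - 1)<..<t k}"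
  shows "\<bar>stencil_error t w k s\<bar> \<le> 27 * r ^ 3 * 4 powr (4 * r) * M * s powr (\<alpha> - 1) / real k ^ 3"
proof -
  define a where "a = t (k - 3)"
  have tk: "t k > 0" using t_pos k by simp
  have a: "t k * 4 powr (- r) \<le> a"
  proof -
    have "real k / 4 \<le> real (k - 3)" using k by simp
    then have "(real k / 4) powr r \<le> real (k - 3) powr r" using r by (intro powr_mono2) auto
    from mult_left_mono[OF this, of \<sigma>] show ?thesis
      using \<sigma> by (simp add: a_def t powr_divide powr_minus_divide)
  qed
  have "0 < a" using t_pos k by (simp add: a_def)
  have s': "0 < s" "s < t k" "a \<le> s"
    using s t_mono[of "k - 3" "k - 1", OF diff_le_mono2] \<open>0 < a\<close> by (auto simp: a_def)
  have diff: "0 \<le> t k - a" "t k - a \<le> 3 * r * t k / real k"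
    using t_diff_le[of "k - 3" k] t_mono[of "k - 3" k] k
    by (simp_all add: a_def t powr_diff of_nat_diff field_simps)
  have "a powr (\<alpha> - 4) \<le> (t k * 4 powr (- r)) powr (\<alpha> - 4)"
    using a tk \<alpha> by (intro powr_mono2') auto
  also have "\<dots> = t k powr (\<alpha> - 4) * 4 powr (r * (4 - \<alpha>))"
    using tk by (simp add: powr_mult powr_powr algebra_simps)
  also have "\<dots> \<le> t k powr (\<alpha> - 4) * 4 powr (4 * r)"
    using \<alpha> r by (intro mult_left_mono powr_mono) auto
  finally have A: "a powr (\<alpha> - 4) \<le> t k powr (\<alpha> - 4) * 4 powr (4 * r)" .
  have "card (t ` {k - 3..k}) = 4"
    using k t_strict_mono by (subst card_image) (auto intro: strict_mono_imp_inj_on inj_on_subset)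
  then have "\<bar>stencil_error t w k s\<bar> \<le> M * a powr (\<alpha> - 4) * (t k - a) ^ 3"
    unfolding stencil_error_def using k s' \<open>0 < a\<close>
    by (intro cubic_interpolation_deriv_error) (auto simp: a_def t_mono)
  also have "\<dots> \<le> M * (t k powr (\<alpha> - 4) * 4 powr (4 * r)) * (3 * r * t k / real k) ^ 3"
    using A diff M_nonneg by (intro mult_mono mult_left_mono power_mono) auto
  also have "\<dots> = 27 * r ^ 3 * 4 powr (4 * r) * M * (t k powr (\<alpha> - 4) * t k powr 3) / real k ^ 3"
    using tk by (simp add: power_divide power_mult_distrib powr_numeral)
  also have "t k powr (\<alpha> - 4) * t k powr 3 = t k powr (\<alpha> - 1)"
    by (simp flip: powr_add)
  also have "27 * r ^ 3 * 4 powr (4 * r) * M * t k powr (\<alpha> - 1) / real k ^ 3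
      \<le> 27 * r ^ 3 * 4 powr (4 * r) * M * s powr (\<alpha> - 1) / real k ^ 3"
    using s' \<alpha> M_nonneg r by (intro divide_right_mono mult_left_mono powr_mono2') auto
  finally show ?thesis .
qed

text \<open>The node 0 rules out any use of the fourth derivative. Interpolant and
  \<open>w 1\<close> are bounded separately, which explains the two summands of the constant.
  Dilation by \<sigma> reduces the interpolant to fixed nodes, where stability needs only the
  increments of \<open>w 0\<close>.\<close>

lemma stencil_error_initial:
  assumes k: "1 \<le> k" "k \<le> 3" "t k \<le> T" and s: "s \<in> {t (k - 1)<..<t k}"
    and A: "0 \<le> A" "\<And>(v :: real \<Rightarrow> real) B y. (\<forall>x\<in>(\<lambda>j. real j powr r) ` {0..k}. \<bar>v x\<bar> \<le> B) \<Longrightarrow>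
        y \<in> {0..3 powr r} \<Longrightarrow>
        \<bar>poly (pderiv (interpolant v ((\<lambda>j. real j powr r) ` {0..k}))) y\<bar> \<le> A * B"
  shows "\<bar>stencil_error t w k s\<bar> \<le> (1 + A * 3 powr r / \<alpha>) * M * s powr (\<alpha> - 1)"
proof -
  define Y where "Y = (\<lambda>j. real j powr r) ` {0..k}"
  define p where "p = interpolant (w 0) (t ` {k - 3..k})"
  define P where "P = interpolant (\<lambda>y. w 0 (\<sigma> * y) - w 0 0) Y"
  have tY: "t ` {k - 3..k} = (*) \<sigma> ` Y"
    using k by (auto simp: Y_def t image_image)
  have t0: "0 \<le> t (k - 1)" using t_mono[of 0 "k - 1"] by simp
  have tk: "t k \<le> \<sigma> * 3 powr r"
    using k \<sigma> r by (auto simp: t intro!: powr_mono2)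
  have "poly (pderiv p) s = poly (pderiv P) (s / \<sigma>) / \<sigma>"
    unfolding p_def tY P_def by (rule pderiv_interpolant_rescale) (use \<sigma> in \<open>auto simp: Y_def\<close>)
  moreover have "\<bar>poly (pderiv P) (s / \<sigma>)\<bar> \<le> A * (M / \<alpha> * (\<sigma> * 3 powr r) powr \<alpha>)"
    unfolding P_def Y_def
  proof (rule A(2), intro ballI)
    fix y assume "y \<in> (\<lambda>j. real j powr r) ` {0..k}"
    then obtain j where j: "j \<le> k" "\<sigma> * y = t j" by (auto simp: t)
    then have tj: "0 \<le> t j" "t j \<le> t k" using t_mono[of 0 j] t_mono[of j k] by auto
    then have "\<bar>w 0 (t j) - w 0 0\<bar> \<le> M / \<alpha> * t j powr \<alpha>"
      using k by (intro increment_bound) auto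
    also have "\<dots> \<le> M / \<alpha> * (\<sigma> * 3 powr r) powr \<alpha>"
      using tj tk M_nonneg \<alpha> by (intro mult_left_mono powr_mono2) auto
    finally show "\<bar>w 0 (\<sigma> * y) - w 0 0\<bar> \<le> M / \<alpha> * (\<sigma> * 3 powr r) powr \<alpha>"
      by (simp add: j)
  next
    show "s / \<sigma> \<in> {0..3 powr r}"
      using s t0 tk \<sigma> by (auto simp: field_simps)
  qed
  ultimately have "\<bar>poly (pderiv p) s\<bar> \<le> A * (M / \<alpha> * (\<sigma> * 3 powr r) powr \<alpha>) / \<sigma>"
    using \<sigma> by (simp only: abs_divide abs_of_pos divide_right_mono less_imp_le)
  \<comment> \<open>One factor \<open>\<sigma> * 3 powr r\<close> is split off the power; its
    \<sigma> cancels the division. The remaining exponent \<open>\<alpha> - 1\<close> is negative,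
    so the base may be lowered to \<open>s\<close>.\<close>
  also have "\<dots> = A * 3 powr r / \<alpha> * M * (\<sigma> * 3 powr r) powr (\<alpha> - 1)"
    using \<sigma> by (simp add: powr_diff)
  also have "\<dots> \<le> A * 3 powr r / \<alpha> * M * s powr (\<alpha> - 1)"
    using s t0 tk \<alpha> A M_nonneg by (intro mult_left_mono powr_mono2') auto
  finally have "\<bar>poly (pderiv p) s\<bar> \<le> A * 3 powr r / \<alpha> * M * s powr (\<alpha> - 1)" .
  moreover have "\<bar>w 1 s\<bar> \<le> M * s powr (\<alpha> - 1)"
    using s t0 k by (intro bound_1) auto
  ultimately show ?thesis
    unfolding stencil_error_def p_def[symmetric] by (simp add: algebra_simps)
qed

end

text \<open>The constant is chosen before \<open>T\<close>, \<open>M\<close>, \<open>w\<close>,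
  \<sigma>, \<open>t\<close> and \<open>k\<close>, so it depends on \<alpha> and \<open>r\<close>
  alone. This is the source of uniformity in the mesh.\<close>

lemma stencil_error_bound:
  assumes "0 < \<alpha>" "1 \<le> r"
  shows "\<exists>B\<ge>0. \<forall>T M w \<sigma> t k s. weakly_singular_graded \<alpha> T M w r \<sigma> t \<longrightarrow> 1 \<le> k \<longrightarrow> t k \<le> T \<longrightarrow>
           s \<in> {t (k - 1)<..<t k} \<longrightarrow>
           \<bar>stencil_error t w k s\<bar> \<le> B * M * s powr (\<alpha> - 1) / real k ^ 3"
proof -
  have "\<exists>A\<ge>0. \<forall>(v :: real \<Rightarrow> real) B.
      (\<forall>x\<in>(\<lambda>j. real j powr r) ` {0..k}. \<bar>v x\<bar> \<le> B) \<longrightarrow>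
      (\<forall>y\<in>{0..3 powr r}. \<bar>poly (pderiv (interpolant v ((\<lambda>j. real j powr r) ` {0..k}))) y\<bar> \<le> A * B)" for k :: nat
    by (rule interpolant_deriv_stable) auto
  then obtain A :: "nat \<Rightarrow> real" where A: "\<And>k. 0 \<le> A k"
    "\<And>k (v :: real \<Rightarrow> real) B y. (\<forall>x\<in>(\<lambda>j. real j powr r) ` {0..k}. \<bar>v x\<bar> \<le> B) \<Longrightarrow>
      y \<in> {0..3 powr r} \<Longrightarrow> \<bar>poly (pderiv (interpolant v ((\<lambda>j. real j powr r) ` {0..k}))) y\<bar> \<le> A k * B"
    by metis
  define B1 where "B1 = 27 * r ^ 3 * 4 powr (4 * r)"
  \<comment> \<open>For \<open>k \<le> 3\<close> the factor \<open>1 / k ^ 3\<close> is bought by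
    27, the largest value of \<open>k ^ 3\<close>; the sum dominates each of the three stability
    constants.\<close>
  define B2 where "B2 = 27 * (1 + (A 1 + A 2 + A 3) * 3 powr r / \<alpha>)"
  have B: "0 \<le> B1" "0 \<le> B2" using assms A(1) by (auto simp: B1_def B2_def)
  show ?thesis
  proof (intro exI[of _ "B1 + B2"] conjI allI impI)
    fix T M w \<sigma> t k s
    assume "weakly_singular_graded \<alpha> T M w r \<sigma> t" and k: "1 \<le> k" "t k \<le> T" "s \<in> {t (k - 1)<..<t k}"
    then interpret weakly_singular_graded \<alpha> T M w r \<sigma> t by simp
    have *: "c * M * s powr (\<alpha> - 1) / real k ^ 3 \<le> (B1 + B2) * M * s powr (\<alpha> - 1) / real k ^ 3"
      if "c \<le> B1 + B2" for c
      using that M_nonneg by (intro divide_right_mono mult_right_mono) auto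
    show "\<bar>stencil_error t w k s\<bar> \<le> (B1 + B2) * M * s powr (\<alpha> - 1) / real k ^ 3"
    proof (cases "4 \<le> k")
      case True
      then show ?thesis
        using stencil_error_interior[of k s] k * [of B1] B by (simp add: B1_def)
    next
      case False
      then have k3: "k = 1 \<or> k = 2 \<or> k = 3" using k by auto
      have "\<bar>stencil_error t w k s\<bar> \<le> (1 + A k * 3 powr r / \<alpha>) * M * s powr (\<alpha> - 1)"
        using k False A by (intro stencil_error_initial) auto
      also have "\<dots> \<le> (1 + A k * 3 powr r / \<alpha>) * M * s powr (\<alpha> - 1) * (27 / real k ^ 3)"
        using k3 mult_left_mono[of 1 "27 / real k ^ 3" "(1 + A k * 3 powr r / \<alpha>) * M * s powr (\<alpha> - 1)"]
          A(1)[of k] assms M_nonneg by auto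
      also have "\<dots> = (27 * (1 + A k * 3 powr r / \<alpha>)) * M * s powr (\<alpha> - 1) / real k ^ 3"
        by simp
      also have "\<dots> \<le> (B1 + B2) * M * s powr (\<alpha> - 1) / real k ^ 3"
      proof (rule *)
        have "A k \<le> A 1 + A 2 + A 3" using k3 A(1)[of 1] A(1)[of 2] A(1)[of 3] by auto
        then have "A k * 3 powr r / \<alpha> \<le> (A 1 + A 2 + A 3) * 3 powr r / \<alpha>"
          using assms by (intro divide_right_mono mult_right_mono) auto
        then show "27 * (1 + A k * 3 powr r / \<alpha>) \<le> B1 + B2" using B by (simp add: B2_def)
      qed
      finally show ?thesis .
    qed
  qed (use B in auto)
qed

subsection \<open>Truncation error of the discrete Caputo operator\<close>

context weakly_singular_graded
begin

lemma kernel_deriv_integrable: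
  assumes "1 \<le> n" "t n \<le> T"
  shows "(\<lambda>s. (t n - s) powr (- \<alpha>) * w 1 s) integrable_on {0..t n}"
proof (rule integrable_weakly_singular)
  show "continuous_on {0<..<t n} (w 1)"
    using assms by (intro continuous_at_imp_continuous_on ballI DERIV_isCont[OF deriv_at]) auto
  show "\<bar>w 1 s\<bar> \<le> M * s powr (\<alpha> - 1)" if "s \<in> {0<..<t n}" for s
    using that assms by (intro bound_1) auto
qed (use assms \<alpha> t_pos in auto)

lemma kernel_poly_integrable:
  assumes "1 \<le> n"
  shows "(\<lambda>s. (t n - s) powr (- \<alpha>) * poly p s) integrable_on {0..t n}"
proof -
  have "bounded (poly p ` {0..t n})"
    by (intro compact_imp_bounded compact_continuous_image continuous_intros) auto
  then obtain C where C: "\<And>s. s \<in> {0..t n} \<Longrightarrow> \<bar>poly p s\<bar> \<le> C"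
    unfolding bounded_iff by (metis imageI real_norm_def)
  have tn: "t n > 0" using assms by (intro t_pos) auto
  show ?thesis
  proof (rule integrable_weakly_singular[where C = "C * t n powr (1 - \<alpha>)"])
    fix s assume s: "s \<in> {0<..<t n}"
    \<comment> \<open>A bounded function is brought into the dominated form: on the open interval
      \<open>t n powr (1 - \<alpha>) * s powr (\<alpha> - 1)\<close> is at least 1.\<close>
    have "1 = t n powr (1 - \<alpha>) * t n powr (\<alpha> - 1)"
      using tn by (simp flip: powr_add)
    also have "\<dots> \<le> t n powr (1 - \<alpha>) * s powr (\<alpha> - 1)"
      using s \<alpha> by (intro mult_left_mono powr_mono2') auto
    finally have "C * 1 \<le> C * (t n powr (1 - \<alpha>) * s powr (\<alpha> - 1))"
      using C[of 0] tn by (intro mult_left_mono) auto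
    then show "\<bar>poly p s\<bar> \<le> C * t n powr (1 - \<alpha>) * s powr (\<alpha> - 1)"
      using C[of s] s by (simp add: mult.assoc)
  qed (use \<alpha> tn in \<open>auto intro!: continuous_intros\<close>)
qed

text \<open>Both ends of the interval are nodes, so the antiderivative \<open>f\<close>, the
  interpolation error itself, vanishes at both. The interior form of the fundamental theorem is
  needed for \<open>k = 1\<close>, where the left end is 0.\<close>

lemma stencil_error_has_integral_0:
  assumes "1 \<le> k" "t k \<le> T"
  shows "(stencil_error t w k has_integral 0) {t (k - 1)..t k}"
proof -
  define p where "p = interpolant (w 0) (t ` {k - 3..k})"
  define f where "f s = poly p s - w 0 s" for s
  have t0: "0 \<le> t (k - 1)" "t (k - 1) \<le> t k"
    using t_mono[of 0 "k - 1"] t_mono[of "k - 1" k] by auto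
  have f0: "f (t j) = 0" if "j \<in> {k - 3..k}" for j
    using that by (auto simp: f_def p_def interpolant(2))
  have "(stencil_error t w k has_integral (f (t k) - f (t (k - 1)))) {t (k - 1)..t k}"
  proof (rule fundamental_theorem_of_calculus_interior[OF t0(2)])
    show "continuous_on {t (k - 1)..t k} f"
      unfolding f_def
      by (intro continuous_intros continuous_on_subset[OF continuous]) (use t0 assms in auto)
    fix s assume "s \<in> {t (k - 1)<..<t k}"
    then have "(w 0 has_real_derivative w 1 s) (at s)"
      using deriv_at[of 0 s] t0 assms by simp
    from DERIV_diff[OF poly_DERIV this, of p]
    show "(f has_vector_derivative stencil_error t w k s) (at s)"
      by (simp add: f_def[abs_def] stencil_error_def p_def has_real_derivative_iff_has_vector_derivative)
  qed
  then show ?thesis using f0[of k] f0[of "k - 1"] assms by auto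
qed

lemma kernel_stencil_error_integrable:
  assumes "1 \<le> k" "k \<le> n" "t n \<le> T"
  shows "(\<lambda>s. (t n - s) powr (- \<alpha>) * stencil_error t w k s) integrable_on {t (k - 1)..t k}"
    and "caputo_piece \<alpha> t (w 0) n k (t ` {k - 3..k})
           - integral {t (k - 1)..t k} (\<lambda>s. (t n - s) powr (- \<alpha>) * w 1 s)
         = integral {t (k - 1)..t k} (\<lambda>s. (t n - s) powr (- \<alpha>) * stencil_error t w k s)"
proof -
  have sub: "{t (k - 1)..t k} \<subseteq> {0..t n}"
    using t_mono[of 0 "k - 1"] t_mono[OF assms(2)] by auto
  have 1: "(\<lambda>s. (t n - s) powr (- \<alpha>) * w 1 s) integrable_on {t (k - 1)..t k}"
    using assms by (intro integrable_on_subinterval[OF kernel_deriv_integrable sub]) auto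
  have 2: "(\<lambda>s. (t n - s) powr (- \<alpha>) * poly (pderiv (interpolant (w 0) (t ` {k - 3..k}))) s)
      integrable_on {t (k - 1)..t k}"
    using assms by (intro integrable_on_subinterval[OF kernel_poly_integrable sub]) auto
  show "(\<lambda>s. (t n - s) powr (- \<alpha>) * stencil_error t w k s) integrable_on {t (k - 1)..t k}"
    unfolding stencil_error_def right_diff_distrib by (rule integrable_diff[OF 2 1])
  show "caputo_piece \<alpha> t (w 0) n k (t ` {k - 3..k})
           - integral {t (k - 1)..t k} (\<lambda>s. (t n - s) powr (- \<alpha>) * w 1 s)
         = integral {t (k - 1)..t k} (\<lambda>s. (t n - s) powr (- \<alpha>) * stencil_error t w k s)"
    unfolding caputo_piece_def stencil_error_def right_diff_distrib
    by (rule integral_diff[OF 2 1, symmetric])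
qed

lemma integral_eq_sum_pieces:
  fixes f :: "real \<Rightarrow> real"
  assumes "f integrable_on {0..t n}" "m \<le> n"
  shows "integral {0..t m} f = (\<Sum>k=1..m. integral {t (k - 1)..t k} f)"
  using assms(2)
proof (induction m)
  case 0
  then show ?case by simp
next
  case (Suc m)
  have "f integrable_on {0..t (Suc m)}"
    using t_mono[OF Suc.prems] by (intro integrable_on_subinterval[OF assms(1)]) auto
  then have "integral {0..t m} f + integral {t m..t (Suc m)} f = integral {0..t (Suc m)} f"
    using t_mono[of 0 m] t_mono[of m "Suc m"] by (intro Henstock_Kurzweil_Integration.integral_combine) auto
  then show ?case using Suc by simp
qed

lemma history_piece_bound:
  assumes k: "1 \<le> k" "k < n" and n: "t n \<le> T" and "0 \<le> B"
    and err: "\<And>s. s \<in> {t (k - 1)<..<t k} \<Longrightarrow>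
      \<bar>stencil_error t w k s\<bar> \<le> B * M * s powr (\<alpha> - 1) / real k ^ 3"
  shows "\<bar>integral {t (k - 1)..t k} (\<lambda>s. (t n - s) powr (- \<alpha>) * stencil_error t w k s)\<bar>
     \<le> B * M * r\<^sup>2 * real n powr (- ((r - 1) * (1 + \<alpha>))) *
         (real k powr (r * (1 + \<alpha>) - 5) * (real n - real k) powr (- (1 + \<alpha>)))"
proof -
  have kpos: "real k > 0" "real n - real k > 0" "real n > 0" using k by auto
  have mono: "0 \<le> t (k - 1)" "t (k - 1) \<le> t k" "t k < t n" "t k > 0" "t k \<le> T"
    using t_mono[of 0 "k - 1"] t_mono[of "k - 1" k] t_strict_mono t_mono[of k n] k n t_pos[of k]
    by (auto simp: strict_mono_def)
  \<comment> \<open>A bound for the interval length. It enters twice, through the kernel increment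
    and through the increment of \<open>t k powr \<alpha>\<close>, whence the factor
    \<open>r\<^sup>2\<close>.\<close>
  define d where "d = \<sigma> * r * real k powr (r - 1)"
  have d: "t k - t (k - 1) \<le> d" "0 \<le> d"
    using t_diff_le[of "k - 1" k] k \<sigma> r by (auto simp: d_def of_nat_diff)
  have 1: "(t n - t k) powr (- \<alpha> - 1) \<le> (\<sigma> * real n powr (r - 1) * (real n - real k)) powr (- \<alpha> - 1)"
    using t_diff_ge[of k n] kpos \<sigma> \<alpha> k by (intro powr_mono2') auto
  have "t k powr \<alpha> - t (k - 1) powr \<alpha> \<le> t k powr (\<alpha> - 1) * (t k - t (k - 1))"
    using mono \<alpha> by (intro powr_diff_le_concave) auto
  also have "\<dots> \<le> t k powr (\<alpha> - 1) * d"
    using d by (intro mult_left_mono) auto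
  finally have 2: "t k powr \<alpha> - t (k - 1) powr \<alpha> \<le> t k powr (\<alpha> - 1) * d" .
  have "\<bar>integral {t (k - 1)..t k} (\<lambda>s. (t n - s) powr (- \<alpha>) * stencil_error t w k s)\<bar>
      \<le> (B * M / real k ^ 3) * (t k - t (k - 1)) * (t n - t k) powr (- \<alpha> - 1) * (t k powr \<alpha> - t (k - 1) powr \<alpha>)"
    using mono k n \<alpha> err stencil_error_has_integral_0[of k] kernel_stencil_error_integrable(1)[of k n]
    by (intro weakly_singular_history_bound) auto
  also have "\<dots> \<le> (B * M / real k ^ 3) * d * (\<sigma> * real n powr (r - 1) * (real n - real k)) powr (- \<alpha> - 1)
      * (t k powr (\<alpha> - 1) * d)"
    using d 1 2 mono M_nonneg \<open>0 \<le> B\<close> \<alpha>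
    by (intro mult_mono mult_nonneg_nonneg) (auto intro: powr_mono2)
  also have "\<dots> = B * M * r\<^sup>2 * real n powr (- ((r - 1) * (1 + \<alpha>))) *
         (real k powr (r * (1 + \<alpha>) - 5) * (real n - real k) powr (- (1 + \<alpha>)))"
  proof -
    have e1: "(\<sigma> * real n powr (r - 1) * (real n - real k)) powr (- \<alpha> - 1)
        = \<sigma> powr (- \<alpha> - 1) * real n powr (- ((r - 1) * (1 + \<alpha>))) * (real n - real k) powr (- (1 + \<alpha>))"
    proof -
      have ex: "- (1 + \<alpha>) = - \<alpha> - 1" "- ((r - 1) * (1 + \<alpha>)) = (r - 1) * (- \<alpha> - 1)"
        by (simp_all add: algebra_simps)
      show ?thesis unfolding ex using kpos \<sigma> by (simp add: powr_mult powr_powr)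
    qed
    have e2: "t k powr (\<alpha> - 1) = \<sigma> powr (\<alpha> - 1) * real k powr (r * (\<alpha> - 1))"
      using kpos \<sigma> by (simp add: t powr_mult powr_powr)
    \<comment> \<open>The scale cancels:
      \<open>(- \<alpha> - 1) + (\<alpha> - 1) + 2 = 0\<close>.\<close>
    have e3: "\<sigma> powr (- \<alpha> - 1) * \<sigma> powr (\<alpha> - 1) * \<sigma>\<^sup>2 = 1"
    proof -
      have "\<sigma>\<^sup>2 = \<sigma> powr 2" using \<sigma> by simp
      then show ?thesis using \<sigma> by (simp only: flip: powr_add) simp
    qed
    \<comment> \<open>Exponent count: \<open>2 * (r - 1) + r * (\<alpha> - 1) - 3 = r * (1 +
      \<alpha>) - 5\<close>.\<close>
    have e4: "(real k powr (r - 1))\<^sup>2 * real k powr (r * (\<alpha> - 1)) / real k ^ 3 = real k powr (r * (1 + \<alpha>) - 5)"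
    proof -
      have k3: "real k ^ 3 = real k powr 3" using kpos by simp
      show ?thesis
        unfolding k3 power2_eq_square powr_add[symmetric] powr_diff[symmetric]
        by (simp add: algebra_simps)
    qed
    have "(B * M / real k ^ 3) * d * (\<sigma> * real n powr (r - 1) * (real n - real k)) powr (- \<alpha> - 1)
        * (t k powr (\<alpha> - 1) * d) =
      B * M * r\<^sup>2 * real n powr (- ((r - 1) * (1 + \<alpha>))) *
        ((real k powr (r - 1))\<^sup>2 * real k powr (r * (\<alpha> - 1)) / real k ^ 3 *
          (real n - real k) powr (- (1 + \<alpha>))) * (\<sigma> powr (- \<alpha> - 1) * \<sigma> powr (\<alpha> - 1) * \<sigma>\<^sup>2)"
      unfolding d_def e1 e2 by (simp only: power2_eq_square divide_inverse mult_ac)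
    then show ?thesis unfolding e3 e4 by simp
  qed
  finally show ?thesis .
qed

text \<open>For \<open>n = 1\<close> the interval touches 0 and the Beta bound applies, the power of
  \<open>n\<close> being 1. For \<open>n \<ge> 2\<close> the scale cancels again and \<open>r *
  (\<alpha> - 1) + (r - 1) * (1 - \<alpha>) - 3 = - (4 - \<alpha>)\<close>.\<close>

lemma last_piece_bound:
  assumes n: "1 \<le> n" "t n \<le> T" and "0 \<le> B"
    and err: "\<And>s. s \<in> {t (n - 1)<..<t n} \<Longrightarrow>
      \<bar>stencil_error t w n s\<bar> \<le> B * M * s powr (\<alpha> - 1) / real n ^ 3"
  shows "\<bar>integral {t (n - 1)..t n} (\<lambda>s. (t n - s) powr (- \<alpha>) * stencil_error t w n s)\<bar>
     \<le> B * M * (Beta \<alpha> (1 - \<alpha>) + 2 powr (r * (1 - \<alpha>)) * r powr (1 - \<alpha>) / (1 - \<alpha>))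
         * real n powr (- (4 - \<alpha>))"
    (is "?I \<le> B * M * (?C1 + ?C2) * _")
proof -
  have C: "0 \<le> ?C1" "0 \<le> ?C2"
    using \<alpha> r by (auto simp: Beta_def Gamma_real_pos intro!: divide_nonneg_pos mult_nonneg_nonneg less_imp_le)
  have BM: "0 \<le> B * M" using \<open>0 \<le> B\<close> M_nonneg by simp
  show ?thesis
  proof (cases "n = 1")
    case True
    have "\<bar>integral {0..t 1} (\<lambda>s. (t 1 - s) powr (- \<alpha>) * stencil_error t w 1 s)\<bar> \<le> B * M * ?C1"
      using err n True \<alpha> t_pos[of 1] kernel_stencil_error_integrable(1)[of 1 1]
      by (intro weakly_singular_first_bound) auto
    then have "?I \<le> B * M * ?C1" using True by simp
    also have "\<dots> \<le> B * M * (?C1 + ?C2)"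
      using C BM by (intro mult_left_mono) auto
    finally show ?thesis using True by simp
  next
    case False
    then have n2: "2 \<le> n" "real n > 0" using n by auto
    have pos: "0 < t (n - 1)" "t (n - 1) \<le> t n" "0 < t n"
      using t_pos[of "n - 1"] t_mono[of "n - 1" n] t_pos[of n] n2 by auto
    \<comment> \<open>From \<open>n - 1 \<ge> n / 2\<close>: the left end of the last interval is
      comparable to \<open>t n\<close>.\<close>
    have "(real n / 2) powr r \<le> real (n - 1) powr r"
      using n2 r by (intro powr_mono2) (auto simp: of_nat_diff)
    from mult_left_mono[OF this, of \<sigma>] have "t n / 2 powr r \<le> t (n - 1)"
      using \<sigma> by (simp add: t powr_divide)
    then have "t (n - 1) powr (\<alpha> - 1) \<le> (t n / 2 powr r) powr (\<alpha> - 1)"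
      using pos \<alpha> by (intro powr_mono2') auto
    also have "\<dots> = \<sigma> powr (\<alpha> - 1) * real n powr (r * (\<alpha> - 1)) * 2 powr (r * (1 - \<alpha>))"
    proof -
      have ex: "r * (1 - \<alpha>) = - (r * (\<alpha> - 1))" by (simp add: algebra_simps)
      show ?thesis
        unfolding ex powr_minus_divide using n2 \<sigma> by (simp add: t powr_mult powr_divide powr_powr)
    qed
    finally have 1: "t (n - 1) powr (\<alpha> - 1) \<le> \<sigma> powr (\<alpha> - 1) * real n powr (r * (\<alpha> - 1)) * 2 powr (r * (1 - \<alpha>))" .
    have "t n - t (n - 1) \<le> \<sigma> * r * real n powr (r - 1)"
      using t_diff_le[of "n - 1" n] n2 by (simp add: of_nat_diff)
    then have "(t n - t (n - 1)) powr (1 - \<alpha>) \<le> (\<sigma> * r * real n powr (r - 1)) powr (1 - \<alpha>)"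
      using pos \<alpha> by (intro powr_mono2) auto
    also have "\<dots> = \<sigma> powr (1 - \<alpha>) * r powr (1 - \<alpha>) * real n powr ((r - 1) * (1 - \<alpha>))"
      using n2 \<sigma> r by (simp add: powr_mult powr_powr)
    finally have 2: "(t n - t (n - 1)) powr (1 - \<alpha>) \<le> \<sigma> powr (1 - \<alpha>) * r powr (1 - \<alpha>) * real n powr ((r - 1) * (1 - \<alpha>))" .
    have "?I \<le> (B * M / real n ^ 3) * t (n - 1) powr (\<alpha> - 1) * (t n - t (n - 1)) powr (1 - \<alpha>) / (1 - \<alpha>)"
      using pos n err \<alpha> BM kernel_stencil_error_integrable(1)[of n n]
      by (intro weakly_singular_last_bound) auto
    also have "\<dots> \<le> (B * M / real n ^ 3) * (\<sigma> powr (\<alpha> - 1) * real n powr (r * (\<alpha> - 1)) * 2 powr (r * (1 - \<alpha>)))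
        * (\<sigma> powr (1 - \<alpha>) * r powr (1 - \<alpha>) * real n powr ((r - 1) * (1 - \<alpha>))) / (1 - \<alpha>)"
      using 1 2 \<open>0 \<le> B\<close> M_nonneg \<alpha> by (intro divide_right_mono mult_mono) auto
    also have "\<dots> = B * M * ?C2 * (\<sigma> powr (\<alpha> - 1) * \<sigma> powr (1 - \<alpha>)) *
        (real n powr (r * (\<alpha> - 1)) * real n powr ((r - 1) * (1 - \<alpha>)) / real n ^ 3)"
      by (simp only: divide_inverse mult_ac)
    also have "\<sigma> powr (\<alpha> - 1) * \<sigma> powr (1 - \<alpha>) = 1"
      using \<sigma> by (simp flip: powr_add)
    also have "real n powr (r * (\<alpha> - 1)) * real n powr ((r - 1) * (1 - \<alpha>)) / real n ^ 3 = real n powr (- (4 - \<alpha>))"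
    proof -
      have n3: "real n ^ 3 = real n powr 3" using n2 by simp
      show ?thesis
        unfolding n3 powr_add[symmetric] powr_diff[symmetric] by (simp add: algebra_simps)
    qed
    also have "B * M * ?C2 * 1 * real n powr (- (4 - \<alpha>)) \<le> B * M * (?C1 + ?C2) * real n powr (- (4 - \<alpha>))"
      unfolding mult_1_right by (intro mult_right_mono) (use C mult_left_mono[OF _ BM, of ?C2 "?C1 + ?C2"] in auto)
    finally show ?thesis .
  qed
qed

lemma sum_pieces_bound:
  assumes n: "1 \<le> n" "t n \<le> T" and "0 \<le> B"
    and err: "\<And>k s. 1 \<le> k \<Longrightarrow> k \<le> n \<Longrightarrow> s \<in> {t (k - 1)<..<t k} \<Longrightarrow>
      \<bar>stencil_error t w k s\<bar> \<le> B * M * s powr (\<alpha> - 1) / real k ^ 3"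
  shows "\<bar>(\<Sum>k=1..n. caputo_piece \<alpha> t (w 0) n k (t ` {k - 3..k}))
           - integral {0..t n} (\<lambda>s. (t n - s) powr (- \<alpha>) * w 1 s)\<bar>
     \<le> B * M * (r\<^sup>2 * (2 powr (2 + \<alpha>) * (\<Sum>k. real k powr (- (1 + \<alpha>)))) +
          (Beta \<alpha> (1 - \<alpha>) + 2 powr (r * (1 - \<alpha>)) * r powr (1 - \<alpha>) / (1 - \<alpha>)))
         * real n powr (- min (4 - \<alpha>) (r * \<alpha>))"
    (is "_ \<le> B * M * (r\<^sup>2 * ?Z + ?L) * _")
proof -
  define m where "m = min (4 - \<alpha>) (r * \<alpha>)"
  define E where "E k = integral {t (k - 1)..t k} (\<lambda>s. (t n - s) powr (- \<alpha>) * stencil_error t w k s)" for k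
  have n0: "1 \<le> real n" using n by simp
  have BM: "0 \<le> B * M" using \<open>0 \<le> B\<close> M_nonneg by simp
  have "(\<Sum>k=1..n. caputo_piece \<alpha> t (w 0) n k (t ` {k - 3..k}))
      - integral {0..t n} (\<lambda>s. (t n - s) powr (- \<alpha>) * w 1 s) = (\<Sum>k=1..n. E k)"
    unfolding E_def integral_eq_sum_pieces[OF kernel_deriv_integrable[OF n] order.refl] sum_subtractf[symmetric]
    using n by (intro sum.cong kernel_stencil_error_integrable(2)) auto
  \<comment> \<open>The last interval is split off because its kernel is singular at
    \<open>t n\<close>, where the history bound does not apply.\<close>
  also have "(\<Sum>k=1..n. E k) = (\<Sum>k=1..<n. E k) + E n"
    using n by (simp add: sum.last_plus add.commute atLeastLessThanSuc_atLeastAtMost[symmetric])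
  also have "\<bar>\<dots>\<bar> \<le> (\<Sum>k=1..<n. \<bar>E k\<bar>) + \<bar>E n\<bar>"
    using sum_abs[of E "{1..<n}"] abs_triangle_ineq[of "\<Sum>k=1..<n. E k" "E n"] by linarith
  also have "(\<Sum>k=1..<n. \<bar>E k\<bar>) \<le> B * M * r\<^sup>2 * ?Z * real n powr (- m)"
  proof -
    \<comment> \<open>This choice makes the final exponent
      \<open>e - (1 + \<alpha>) - (r - 1) * (1 + \<alpha>)\<close> equal to \<open>- m\<close>. Then
      \<open>m \<le> r * \<alpha>\<close> gives \<open>e \<ge> 0\<close>, and
      \<open>m \<le> 4 - \<alpha>\<close> gives
      \<open>r * (1 + \<alpha>) - 5 \<le> e - (1 + \<alpha>)\<close>.\<close>
    define e where "e = r * (1 + \<alpha>) - m"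
    have "0 \<le> r * (1 + \<alpha>) - r * \<alpha>" using r by (simp add: algebra_simps)
    then have e: "0 \<le> e" by (simp add: e_def m_def min_def)
    have "(\<Sum>k=1..<n. \<bar>E k\<bar>) \<le> (\<Sum>k=1..<n. B * M * r\<^sup>2 * real n powr (- ((r - 1) * (1 + \<alpha>))) *
        (real k powr (e - (1 + \<alpha>)) * (real n - real k) powr (- (1 + \<alpha>))))"
    proof (rule sum_mono)
      fix k assume k: "k \<in> {1..<n}"
      have "\<bar>E k\<bar> \<le> B * M * r\<^sup>2 * real n powr (- ((r - 1) * (1 + \<alpha>))) *
        (real k powr (r * (1 + \<alpha>) - 5) * (real n - real k) powr (- (1 + \<alpha>)))"
        unfolding E_def using k n err \<open>0 \<le> B\<close> by (intro history_piece_bound) auto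
      also have "\<dots> \<le> B * M * r\<^sup>2 * real n powr (- ((r - 1) * (1 + \<alpha>))) *
        (real k powr (e - (1 + \<alpha>)) * (real n - real k) powr (- (1 + \<alpha>)))"
        using k BM by (intro mult_left_mono mult_right_mono powr_mono) (auto simp: e_def m_def)
      finally show "\<bar>E k\<bar> \<le> B * M * r\<^sup>2 * real n powr (- ((r - 1) * (1 + \<alpha>))) *
        (real k powr (e - (1 + \<alpha>)) * (real n - real k) powr (- (1 + \<alpha>)))" .
    qed
    also have "\<dots> = B * M * r\<^sup>2 * real n powr (- ((r - 1) * (1 + \<alpha>))) *
        (\<Sum>k=1..<n. real k powr (e - (1 + \<alpha>)) * (real n - real k) powr (- (1 + \<alpha>)))"
      by (simp only: sum_distrib_left)
    also have "\<dots> \<le> B * M * r\<^sup>2 * real n powr (- ((r - 1) * (1 + \<alpha>))) * (?Z * real n powr (e - (1 + \<alpha>)))"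
      using convolution_powr_sum_le[OF e, of "1 + \<alpha>" n] \<alpha> BM
      by (intro mult_left_mono) (auto simp: add.commute)
    also have "\<dots> = B * M * r\<^sup>2 * ?Z * (real n powr (- ((r - 1) * (1 + \<alpha>))) * real n powr (e - (1 + \<alpha>)))"
      by simp
    also have "real n powr (- ((r - 1) * (1 + \<alpha>))) * real n powr (e - (1 + \<alpha>)) = real n powr (- m)"
      unfolding powr_add[symmetric] by (simp add: e_def algebra_simps)
    finally show ?thesis .
  qed
  also have "\<bar>E n\<bar> \<le> B * M * ?L * real n powr (- m)"
  proof -
    have "\<bar>E n\<bar> \<le> B * M * ?L * real n powr (- (4 - \<alpha>))"
      unfolding E_def using n err \<open>0 \<le> B\<close> by (intro last_piece_bound) auto
    also have "\<dots> \<le> B * M * ?L * real n powr (- m)"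
      using n0 BM \<alpha> r
      by (intro mult_left_mono powr_mono mult_nonneg_nonneg[OF BM])
        (auto simp: m_def Beta_def intro!: add_nonneg_nonneg divide_nonneg_pos mult_nonneg_nonneg less_imp_le[OF Gamma_real_pos])
    finally show ?thesis .
  qed
  finally show ?thesis unfolding m_def by (simp add: algebra_simps)
qed

end

section \<open>From the hypotheses and operators of the theorem to the locale setting\<close>

lemma discrete_caputo_eq_sum:
  assumes "1 \<le> n"
  shows "discrete_caputo \<alpha> t v n =
           1 / Gamma (1 - \<alpha>) * (\<Sum>k=1..n. caputo_piece \<alpha> t v n k (t ` {k - 3..k}))"
proof -
  define c where "c k = caputo_piece \<alpha> t v n k (t ` {k - 3..k})" for k
  have *: "{0..1::nat} = {0, 1}" "{0..2::nat} = {0, 1, 2}" by auto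
  have 1: "c 1 = caputo_piece \<alpha> t v n 1 {t 0, t 1}" and 2: "c 2 = caputo_piece \<alpha> t v n 2 {t 0, t 1, t 2}"
    by (simp_all add: c_def * del: One_nat_def)
  have 3: "(\<Sum>k=3..n. caputo_piece \<alpha> t v n k {t (k - 3), t (k - 2), t (k - 1), t k}) = (\<Sum>k=3..n. c k)"
  proof (rule sum.cong)
    fix k assume "k \<in> {3..n}"
    then have "{k - 3..k} = {k - 3, k - 2, k - 1, k}" by auto
    then show "caputo_piece \<alpha> t v n k {t (k - 3), t (k - 2), t (k - 1), t k} = c k"
      by (simp add: c_def)
  qed simp
  have "c 1 + (if 2 \<le> n then c 2 else 0) + (\<Sum>k=3..n. c k) = (\<Sum>k=1..n. c k)"
  proof (cases "2 \<le> n")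
    case True
    then show ?thesis
      using sum.atLeast_Suc_atMost[of 1 n c] sum.atLeast_Suc_atMost[of 2 n c] by (simp add: numeral_2_eq_2 numeral_3_eq_3)
  next
    case False
    then have "n = 1" using assms by simp
    then show ?thesis by simp
  qed
  then show ?thesis
    unfolding discrete_caputo_def 1[symmetric] 2[symmetric] 3 by (simp add: c_def)
qed


text \<open>The exponent \<open>\<alpha> - l\<close> is negative, so on \<open>(0, T]\<close> the
  power of \<open>t\<close> is bounded below. The base \<open>1 + T\<close>, being at least 1,
  allows one factor for all \<open>l\<close> up to 4, and the absolute value is taken because
  \<open>C\<close> may be negative.\<close>

lemma derivative_bound_absorb_constant:
  fixes \<alpha> C t T :: real
  assumes "\<alpha> < 1" "0 < t" "t \<le> T" "1 \<le> l" "l \<le> 4" "0 < \<alpha>"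
  shows "C * (1 + t powr (\<alpha> - real l)) \<le> \<bar>C\<bar> * (1 + (1 + T) powr 4) * t powr (\<alpha> - real l)"
proof -
  have "t powr (real l - \<alpha>) \<le> (1 + T) powr (real l - \<alpha>)"
    using assms by (intro powr_mono2) auto
  also have "\<dots> \<le> (1 + T) powr 4"
    using assms by (intro powr_mono) auto
  finally have "t powr (real l - \<alpha>) * t powr (\<alpha> - real l) \<le> (1 + T) powr 4 * t powr (\<alpha> - real l)"
    by (intro mult_right_mono) auto
  also have "t powr (real l - \<alpha>) * t powr (\<alpha> - real l) = 1"
    using assms by (simp flip: powr_add)
  finally have "1 + t powr (\<alpha> - real l) \<le> (1 + (1 + T) powr 4) * t powr (\<alpha> - real l)"
    by (simp add: algebra_simps)
  then have "\<bar>C\<bar> * (1 + t powr (\<alpha> - real l)) \<le> \<bar>C\<bar> * ((1 + (1 + T) powr 4) * t powr (\<alpha> - real l))"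
    by (intro mult_left_mono) auto
  moreover have "C * (1 + t powr (\<alpha> - real l)) \<le> \<bar>C\<bar> * (1 + t powr (\<alpha> - real l))"
    by (intro mult_right_mono) auto
  ultimately show ?thesis by (simp add: mult.assoc)
qed

lemma C_on_imp_has_real_derivative:
  assumes "C_on n {0<..T} f" "l < n" "s \<in> {0<..T}"
  shows "(deriv_within l {0<..T} f has_real_derivative deriv_within (Suc l) {0<..T} f s) (at s within {0<..T})"
proof -
  have "deriv_within l {0<..T} f differentiable (at s within {0<..T})"
    using assms by (auto simp: C_on_def differentiable_on_def)
  then show ?thesis
    by (simp add: has_real_derivative_iff_has_vector_derivative vector_derivative_works)
qed

theorem lemma1:
  fixes \<alpha> r T L :: real and u :: "real \<Rightarrow> real \<Rightarrow> real"
  assumes "0 < \<alpha>" and "\<alpha> < 1" and "1 \<le> r" and "0 < T" and "0 < L"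
    and "\<And>x. x \<in> {0..L} \<Longrightarrow> continuous_on {0..T} (u x)"
    and "\<And>x. x \<in> {0..L} \<Longrightarrow> C_on 4 {0<..T} (u x)"
    and "\<exists>C. \<forall>x\<in>{0..L}. \<forall>t\<in>{0<..T}. \<forall>l\<le>4.
           \<bar>deriv_within l {0<..T} (u x) t\<bar> \<le> C * (1 + t powr (\<alpha> - real l))"
  shows "\<exists>C>0. \<forall>Kt Kx :: nat. 0 < Kt \<longrightarrow> 0 < Kx \<longrightarrow>
           (\<forall>i\<in>{1..Kx - 1}. \<forall>n\<in>{1..Kt}.
             \<bar>discrete_caputo \<alpha> (graded_mesh T r Kt) (u (real i * L / real Kx)) n
               - caputo \<alpha> (u (real i * L / real Kx)) (graded_mesh T r Kt n)\<bar>
             \<le> C * real n powr (- min (4 - \<alpha>) (r * \<alpha>)))"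
proof -
  obtain C where C: "\<And>x t l. x \<in> {0..L} \<Longrightarrow> t \<in> {0<..T} \<Longrightarrow> l \<le> 4 \<Longrightarrow>
      \<bar>deriv_within l {0<..T} (u x) t\<bar> \<le> C * (1 + t powr (\<alpha> - real l))"
    using assms(8) by blast
  define M where "M = \<bar>C\<bar> * (1 + (1 + T) powr 4)"
  obtain B where B: "0 \<le> B"
    "\<And>T M w \<sigma> t k s. weakly_singular_graded \<alpha> T M w r \<sigma> t \<Longrightarrow> 1 \<le> k \<Longrightarrow> t k \<le> T \<Longrightarrow>
       s \<in> {t (k - 1)<..<t k} \<Longrightarrow> \<bar>stencil_error t w k s\<bar> \<le> B * M * s powr (\<alpha> - 1) / real k ^ 3"
    using stencil_error_bound[OF assms(1,3)] by metis
  \<comment> \<open>All ingredients are fixed before \<open>x\<close>, \<open>n\<close> and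
    \<open>Kt\<close>, so one constant serves every mesh point.\<close>
  define A where "A = B * M * (r\<^sup>2 * (2 powr (2 + \<alpha>) * (\<Sum>k. real k powr (- (1 + \<alpha>)))) +
      (Beta \<alpha> (1 - \<alpha>) + 2 powr (r * (1 - \<alpha>)) * r powr (1 - \<alpha>) / (1 - \<alpha>)))"
  have Gam: "0 < Gamma (1 - \<alpha>)" using assms by (intro Gamma_real_pos) auto
  have bound: "\<bar>discrete_caputo \<alpha> (graded_mesh T r Kt) (u x) n - caputo \<alpha> (u x) (graded_mesh T r Kt n)\<bar>
      \<le> A / Gamma (1 - \<alpha>) * real n powr (- min (4 - \<alpha>) (r * \<alpha>))"
    if x: "x \<in> {0..L}" and n: "1 \<le> n" "n \<le> Kt" for x n Kt
  proof -
    define w where "w l = deriv_within l {0<..T} (u x)" for l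
    define t where "t = graded_mesh T r Kt"
    interpret weakly_singular_graded \<alpha> T M w r "T / real Kt powr r" t
    proof
      show "continuous_on {0..T} (w 0)" using assms(6)[OF x] by (simp add: w_def)
      show "(w l has_real_derivative w (Suc l) s) (at s within {0<..T})" if "l < 4" "s \<in> {0<..T}" for l s
        unfolding w_def by (rule C_on_imp_has_real_derivative[OF assms(7)[OF x] that])
      show "\<bar>w l s\<bar> \<le> M * s powr (\<alpha> - real l)" if "1 \<le> l" "l \<le> 4" "s \<in> {0<..T}" for l s
        unfolding w_def M_def
        by (rule order.trans[OF C derivative_bound_absorb_constant]) (use x that assms in auto)
      show "t k = T / real Kt powr r * real k powr r" for k
        by (simp add: t_def graded_mesh_def powr_divide)
    qed (use assms n in auto)
    have "t Kt = T" using n by (simp add: t_def graded_mesh_def)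
    then have tn: "t n \<le> T" using t_mono[OF n(2)] by simp
    have "caputo \<alpha> (u x) (t n) = 1 / Gamma (1 - \<alpha>) * integral {0..t n} (\<lambda>s. (t n - s) powr (- \<alpha>) * w 1 s)"
    proof -
      \<comment> \<open>The two-sided derivative agrees with the one within \<open>{0<..T}\<close>
        at interior points; the two excluded end points form a null set.\<close>
      have "deriv (w 0) s = w 1 s" if "s \<in> {0..t n} - {0, t n}" for s
        using deriv_at[of 0 s] that tn by (intro DERIV_imp_deriv) auto
      then have "integral {0..t n} (\<lambda>s. (t n - s) powr (- \<alpha>) * deriv (w 0) s)
          = integral {0..t n} (\<lambda>s. (t n - s) powr (- \<alpha>) * w 1 s)"
        by (intro integral_spike[of "{0, t n}"]) auto
      moreover have "w 0 = u x" by (simp add: w_def fun_eq_iff)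
      ultimately show ?thesis by (simp add: caputo_def)
    qed
    moreover have "discrete_caputo \<alpha> t (u x) n =
        1 / Gamma (1 - \<alpha>) * (\<Sum>k=1..n. caputo_piece \<alpha> t (w 0) n k (t ` {k - 3..k}))"
      using discrete_caputo_eq_sum[OF n(1)] by (simp add: w_def)
    ultimately have "\<bar>discrete_caputo \<alpha> t (u x) n - caputo \<alpha> (u x) (t n)\<bar> = 1 / Gamma (1 - \<alpha>) *
        \<bar>(\<Sum>k=1..n. caputo_piece \<alpha> t (w 0) n k (t ` {k - 3..k}))
           - integral {0..t n} (\<lambda>s. (t n - s) powr (- \<alpha>) * w 1 s)\<bar>"
      using Gam by (simp add: abs_mult flip: right_diff_distrib diff_divide_distrib)
    also have "\<dots> \<le> 1 / Gamma (1 - \<alpha>) * (A * real n powr (- min (4 - \<alpha>) (r * \<alpha>)))"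
    proof (rule mult_left_mono)
      show "\<bar>(\<Sum>k=1..n. caputo_piece \<alpha> t (w 0) n k (t ` {k - 3..k}))
           - integral {0..t n} (\<lambda>s. (t n - s) powr (- \<alpha>) * w 1 s)\<bar>
          \<le> A * real n powr (- min (4 - \<alpha>) (r * \<alpha>))"
        unfolding A_def
      proof (rule sum_pieces_bound[OF n(1) tn B(1)])
        fix k s assume k: "1 \<le> k" "k \<le> n" "s \<in> {t (k - 1)<..<t k}"
        have "t k \<le> T" using t_mono[OF k(2)] tn by simp
        then show "\<bar>stencil_error t w k s\<bar> \<le> B * M * s powr (\<alpha> - 1) / real k ^ 3"
          using k by (intro B(2)[OF weakly_singular_graded_axioms]) auto
      qed
    qed (use Gam in auto)
    finally show ?thesis by (simp add: t_def)
  qed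
  show ?thesis
  \<comment> \<open>Adding 1 secures strict positivity of the constant.\<close>
  proof (intro exI[of _ "\<bar>A / Gamma (1 - \<alpha>)\<bar> + 1"] conjI allI impI ballI)
    fix Kt Kx i n :: nat
    assume i: "0 < Kt" "0 < Kx" "i \<in> {1..Kx - 1}" "n \<in> {1..Kt}"
    have "real i * L \<le> real Kx * L" using i assms by (intro mult_right_mono) auto
    then have x: "real i * L / real Kx \<in> {0..L}"
      using i assms by (auto simp: field_simps)
    have "\<bar>discrete_caputo \<alpha> (graded_mesh T r Kt) (u (real i * L / real Kx)) n
        - caputo \<alpha> (u (real i * L / real Kx)) (graded_mesh T r Kt n)\<bar>
      \<le> A / Gamma (1 - \<alpha>) * real n powr (- min (4 - \<alpha>) (r * \<alpha>))"
      using bound[OF x] i by simp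
    also have "\<dots> \<le> (\<bar>A / Gamma (1 - \<alpha>)\<bar> + 1) * real n powr (- min (4 - \<alpha>) (r * \<alpha>))"
      using abs_ge_self[of "A / Gamma (1 - \<alpha>)"] by (intro mult_right_mono) (linarith, simp)
    finally show "\<bar>discrete_caputo \<alpha> (graded_mesh T r Kt) (u (real i * L / real Kx)) n
        - caputo \<alpha> (u (real i * L / real Kx)) (graded_mesh T r Kt n)\<bar>
      \<le> (\<bar>A / Gamma (1 - \<alpha>)\<bar> + 1) * real n powr (- min (4 - \<alpha>) (r * \<alpha>))" .
  qed (rule add_nonneg_pos[OF abs_ge_zero zero_less_one])
qed

end
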